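(* Let $\gamma$ be a continuous function on $\mathbb{R}^+=[0,\infty)$ with $0<\gamma(x)<1$, and let $\beta$ be a probability density function with support set $(0,a)$, where $0<a\le\infty$. Let $(X_n)_{n\ge0}$ be the Markov chain on $\mathbb{R}^+$ with one-step transition kernel $$P(x,\mathrm{d}y)=\begin{cases}\beta(y)\,\mathrm{d}y,&x=0,\\ \gamma(x)\delta_{\{0\}}(\mathrm{d}y)+(1-\gamma(x))\delta_{\{x+1\}}(\mathrm{d}y),&x>0.\end{cases}$$ Then: (1) $\{X_n\}$ is recurrent if there exists $x_1>0$ such that $\prod_{k=[x_1]}^{\infty}\sup_{k\le x<k+1}(1-\gamma(x))=0$; $\{X_n\}$ is transient if there exists $x_1>0$ such that $\prod_{k=[x_1]}^{\infty}\inf_{k\le x<k+1}(1-\gamma(x))>0$. (2) $\{X_n\}$ is non-ergodic if there exists $x_1>0$ such that $\int_{x_1}^\infty\frac{\beta(x)}{\sup_{y\ge x}\gamma(y)}\,\mathrm{d}x=\infty$; $\{X_n\}$ is ergodic if there exists $x_1>0$ such that $$\sup_{x>x_1}\left(\frac1{\gamma(x+1)}-\frac1{\gamma(x)}\right)<1\quad\text{and}\quad\int_{x_1}^\infty\frac{\beta(y)}{\gamma(y)}\,\mathrm{d}y<\infty.$$ (3) $\{X_n\}$ is non-geometrically ergodic and non-strongly ergodic if $\limsup_{x\to\infty}\gamma(x)=0$. (4) $\{X_n\}$ is strongly ergodic if $\liminf_{x\to\infty}\gamma(x)>0$.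
   Context: $[x]$ denotes the integer part of $x$, and $\delta_{\{z\}}$ the Dirac measure at $z$. For a Markov chain on a state space $(\mathscr{X},\mathscr{B}(\mathscr{X}))$ (here $\mathscr{X}=\mathbb{R}^+$ with its Borel sets), with $n$-step kernels $P^n$, $\psi$-irreducibility means there is a $\sigma$-finite measure $\psi$ with $\sum_{n\ge1}P^n(x,A)>0$ for all $x$ whenever $\psi(A)>0$; $\psi$ is taken to be a maximal irreducibility measure (every irreducibility measure is absolutely continuous with respect to it), and $\mathscr{B}^+(\mathscr{X})=\{A:\psi(A)>0\}$. A set $C\in\mathscr{B}(\mathscr{X})$ is petite if there are a probability distribution $\{a_n\}$ on $\mathbb{Z}_+$ and a non-trivial measure $\nu_a$ with $\sum_{n\ge0}a_nP^n(x,B)\ge\nu_a(B)$ for all $x\in C$, $B\in\mathscr{B}(\mathscr{X})$. $\tau_A^+=\inf\{n\ge1:X_n\in A\}$. Recurrent means Harris recurrent: $\mathbb{P}_x(\sum_{n\ge1}\mathbf{1}_{\{X_n\in A\}}=\infty)=1$ for all $x\in\mathscr{X}$, $A\in\mathscr{B}^+(\mathscr{X})$. Transient: it is not the case that $\sum_{n\ge1}P^n(x,A)=\infty$ for all $x\in\mathscr{X}$ and $A\in\mathscr{B}^+(\mathscr{X})$. Ergodic: Harris recurrent and there is a petite $C\in\mathscr{B}^+(\mathscr{X})$ with $\sup_{x\in C}\mathbb{E}_x\tau_C^+<\infty$ (equivalently, Harris recurrent with an invariant probability measure). Geometrically ergodic: there are a nonempty petite set $C\in\mathscr{B}(\mathscr{X})$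 and $r>1$ with $\sup_{x\in C}\mathbb{E}_xr^{\tau_C^+}<\infty$. Strongly ergodic: there is a petite set $C\in\mathscr{B}(\mathscr{X})$ with $\sup_{x\in\mathscr{X}}\mathbb{E}_x\tau_C^+<\infty$. "Non-" denotes negation. *)

theory Defs
  imports "HOL-Probability.Probability"
begin

section \<open>Markov chains on a general state space\<close>

text \<open>The state space is a measurable space \<open>S\<close>, and a transition kernel is a family
  \<open>K x\<close> of probability measures on \<open>S\<close>.\<close>

primrec kernel_pow :: "'a measure \<Rightarrow> ('a \<Rightarrow> 'a measure) \<Rightarrow> nat \<Rightarrow> 'a \<Rightarrow> 'a measure" where
  "kernel_pow S K 0 x = return S x"
| "kernel_pow S K (Suc n) x = K x \<bind> kernel_pow S K n"

definition past_events :: "'a measure \<Rightarrow> 'w measure \<Rightarrow> (nat \<Rightarrow> 'w \<Rightarrow> 'a) \<Rightarrow> nat \<Rightarrow> 'w set set" where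
  "past_events S M X n =
     sigma_sets (space M) {X i -` A \<inter> space M | i A. i \<le> n \<and> A \<in> sets S}"

text \<open>\<open>PP x\<close> is the law of the chain started at \<open>x\<close>. The last clause says that
  \<open>K (X n) A\<close> is a version of the conditional probability of \<open>X (n+1) \<in> A\<close> given
  \<open>X 0, \<dots>, X n\<close>.\<close>

definition markov_chain ::
  "'a measure \<Rightarrow> ('a \<Rightarrow> 'a measure) \<Rightarrow> ('a \<Rightarrow> 'w measure) \<Rightarrow> (nat \<Rightarrow> 'w \<Rightarrow> 'a) \<Rightarrow> bool" where
  "markov_chain S K PP X \<longleftrightarrow>
     (\<forall>x\<in>space S.
        prob_space (PP x) \<and>
        (\<forall>n. X n \<in> measurable (PP x) S) \<and>
        (AE \<omega> in PP x. X 0 \<omega> = x) \<and>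
        (\<forall>n. \<forall>B\<in>past_events S (PP x) X n. \<forall>A\<in>sets S.
           emeasure (PP x) (B \<inter> X (Suc n) -` A) = (\<integral>\<^sup>+\<omega>\<in>B. emeasure (K (X n \<omega>)) A \<partial>PP x)))"

subsection \<open>Irreducibility and petite sets\<close>

definition irreducibility_measure :: "'a measure \<Rightarrow> ('a \<Rightarrow> 'a measure) \<Rightarrow> 'a measure \<Rightarrow> bool" where
  "irreducibility_measure S K \<phi> \<longleftrightarrow>
     sets \<phi> = sets S \<and> sigma_finite_measure \<phi> \<and>
     (\<forall>A\<in>sets S. emeasure \<phi> A > 0 \<longrightarrow>
        (\<forall>x\<in>space S. (\<Sum>n. emeasure (kernel_pow S K (Suc n) x) A) > 0))"

definition maximal_irreducibility_measure ::
  "'a measure \<Rightarrow> ('a \<Rightarrow> 'a measure) \<Rightarrow> 'a measure \<Rightarrow> bool" where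
  "maximal_irreducibility_measure S K \<psi> \<longleftrightarrow>
     irreducibility_measure S K \<psi> \<and>
     (\<forall>\<phi>. irreducibility_measure S K \<phi> \<longrightarrow> absolutely_continuous \<psi> \<phi>)"

text \<open>Any two maximal irreducibility measures have the same null sets, so the choice of
  \<open>\<psi>\<close> is immaterial. In a chain that is not irreducible there is none and the family is empty.\<close>

definition positive_sets :: "'a measure \<Rightarrow> ('a \<Rightarrow> 'a measure) \<Rightarrow> 'a set set" where
  "positive_sets S K =
     {A \<in> sets S. \<exists>\<psi>. maximal_irreducibility_measure S K \<psi> \<and> emeasure \<psi> A > 0}"

definition petite :: "'a measure \<Rightarrow> ('a \<Rightarrow> 'a measure) \<Rightarrow> 'a set \<Rightarrow> bool" where
  "petite S K C \<longleftrightarrow>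
     C \<in> sets S \<and>
     (\<exists>(a :: nat pmf) \<nu>. sets \<nu> = sets S \<and> emeasure \<nu> (space \<nu>) > 0 \<and>
        (\<forall>x\<in>C. \<forall>B\<in>sets S.
           (\<Sum>n. ennreal (pmf a n) * emeasure (kernel_pow S K n x) B) \<ge> emeasure \<nu> B))"

subsection \<open>Return times\<close>

definition return_time :: "(nat \<Rightarrow> 'w \<Rightarrow> 'a) \<Rightarrow> 'a set \<Rightarrow> 'w \<Rightarrow> enat" where
  "return_time X A \<omega> = (INF n\<in>{n. 1 \<le> n \<and> X n \<omega> \<in> A}. enat n)"

text \<open>The convention \<open>r\<^sup>\<infinity> = \<infinity>\<close> is the right one for \<open>r > 1\<close>, the only case used.\<close>

definition power_enat :: "real \<Rightarrow> enat \<Rightarrow> ennreal" where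
  "power_enat r t = (case t of enat n \<Rightarrow> ennreal (r ^ n) | \<infinity> \<Rightarrow> \<infinity>)"

subsection \<open>Recurrence and ergodicity\<close>

definition harris_recurrent ::
  "'a measure \<Rightarrow> ('a \<Rightarrow> 'a measure) \<Rightarrow> ('a \<Rightarrow> 'w measure) \<Rightarrow> (nat \<Rightarrow> 'w \<Rightarrow> 'a) \<Rightarrow> bool" where
  "harris_recurrent S K PP X \<longleftrightarrow>
     (\<forall>x\<in>space S. \<forall>A\<in>positive_sets S K.
        \<P>(\<omega> in PP x. (\<Sum>n. indicator A (X (Suc n) \<omega>)) = (\<infinity> :: ennreal)) = 1)"

definition transient :: "'a measure \<Rightarrow> ('a \<Rightarrow> 'a measure) \<Rightarrow> bool" where
  "transient S K \<longleftrightarrow>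
     \<not> (\<forall>x\<in>space S. \<forall>A\<in>positive_sets S K.
          (\<Sum>n. emeasure (kernel_pow S K (Suc n) x) A) = \<infinity>)"

definition ergodic ::
  "'a measure \<Rightarrow> ('a \<Rightarrow> 'a measure) \<Rightarrow> ('a \<Rightarrow> 'w measure) \<Rightarrow> (nat \<Rightarrow> 'w \<Rightarrow> 'a) \<Rightarrow> bool" where
  "ergodic S K PP X \<longleftrightarrow>
     harris_recurrent S K PP X \<and>
     (\<exists>C. petite S K C \<and> C \<in> positive_sets S K \<and>
        (SUP x\<in>C. \<integral>\<^sup>+\<omega>. ennreal_of_enat (return_time X C \<omega>) \<partial>PP x) < \<infinity>)"

definition geometrically_ergodic ::
  "'a measure \<Rightarrow> ('a \<Rightarrow> 'a measure) \<Rightarrow> ('a \<Rightarrow> 'w measure) \<Rightarrow> (nat \<Rightarrow> 'w \<Rightarrow> 'a) \<Rightarrow> bool" where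
  "geometrically_ergodic S K PP X \<longleftrightarrow>
     (\<exists>C r. petite S K C \<and> C \<noteq> {} \<and> r > 1 \<and>
        (SUP x\<in>C. \<integral>\<^sup>+\<omega>. power_enat r (return_time X C \<omega>) \<partial>PP x) < \<infinity>)"

definition strongly_ergodic ::
  "'a measure \<Rightarrow> ('a \<Rightarrow> 'a measure) \<Rightarrow> ('a \<Rightarrow> 'w measure) \<Rightarrow> (nat \<Rightarrow> 'w \<Rightarrow> 'a) \<Rightarrow> bool" where
  "strongly_ergodic S K PP X \<longleftrightarrow>
     (\<exists>C. petite S K C \<and>
        (SUP x\<in>space S. \<integral>\<^sup>+\<omega>. ennreal_of_enat (return_time X C \<omega>) \<partial>PP x) < \<infinity>)"

section \<open>The chain on the half-line\<close>

definition half_line :: "real measure" where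
  "half_line = restrict_space borel {0..}"

text \<open>The value of \<open>jump_kernel\<close> at negative arguments, which are not states, is irrelevant.\<close>

definition jump_kernel :: "(real \<Rightarrow> real) \<Rightarrow> (real \<Rightarrow> real) \<Rightarrow> real \<Rightarrow> real measure" where
  "jump_kernel \<gamma> \<beta> x =
     (if x = 0 then density (restrict_space lborel {0..}) (\<lambda>y. ennreal (\<beta> y))
      else measure_of (space half_line) (sets half_line)
        (\<lambda>A. ennreal (\<gamma> x) * emeasure (return half_line 0) A +
             ennreal (1 - \<gamma> x) * emeasure (return half_line (x + 1)) A))"

lemma space_half_line [simp]: "space half_line = {0..}"
  by (simp add: half_line_def space_restrict_space)

lemma sets_jump_kernel [simp]: "sets (jump_kernel \<gamma> \<beta> x) = sets half_line"
proof (cases "x = 0")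
  case True
  then show ?thesis
    by (simp add: jump_kernel_def half_line_def sets_restrict_space_cong[of lborel borel])
next
  case False
  then show ?thesis
    by (simp only: jump_kernel_def if_False sets_measure_of[OF sets.space_closed] sets.sigma_sets_eq)
qed

text \<open>The set function given to \<open>measure_of\<close> is countably additive, so \<open>measure_of\<close>
  does not fall back to the zero measure.\<close>

lemma emeasure_jump_kernel_pos:
  assumes "x > 0" and A: "A \<in> sets half_line"
  shows "emeasure (jump_kernel \<gamma> \<beta> x) A =
    ennreal (\<gamma> x) * indicator A 0 + ennreal (1 - \<gamma> x) * indicator A (x + 1)"
proof -
  let ?\<mu> = "\<lambda>A. ennreal (\<gamma> x) * emeasure (return half_line 0) A +
             ennreal (1 - \<gamma> x) * emeasure (return half_line (x + 1)) A"
  have "countably_additive (sets half_line) ?\<mu>"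
  proof (rule countably_additiveI)
    fix F :: "nat \<Rightarrow> real set"
    assume F: "range F \<subseteq> sets half_line" "disjoint_family F" "(\<Union>i. F i) \<in> sets half_line"
    have "(\<Sum>i. ?\<mu> (F i)) = ennreal (\<gamma> x) * (\<Sum>i. emeasure (return half_line 0) (F i)) +
        ennreal (1 - \<gamma> x) * (\<Sum>i. emeasure (return half_line (x + 1)) (F i))"
      by (simp add: suminf_add[symmetric] ennreal_suminf_cmult)
    also have "\<dots> = ?\<mu> (\<Union>i. F i)"
      using F by (simp add: suminf_emeasure del: emeasure_return)
    finally show "(\<Sum>i. ?\<mu> (F i)) = ?\<mu> (\<Union>i. F i)" .
  qed
  moreover have "positive (sets half_line) ?\<mu>"
    by (simp add: positive_def)
  ultimately have "emeasure (measure_of (space half_line) (sets half_line) ?\<mu>) A = ?\<mu> A"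
    using A by (intro emeasure_measure_of_sigma[OF sets.sigma_algebra_axioms])
  then show ?thesis
    using assms by (simp add: jump_kernel_def)
qed

end

theory Submission
  imports Defs
begin

text \<open>
  Everything is reduced to the probabilities of avoiding a set for \<open>n\<close> steps. From \<open>x > 0\<close> the
  chain can only climb or jump to \<open>0\<close>, so it avoids \<open>0\<close> for \<open>n\<close> steps with probability
  \<open>\<Prod>j<n. 1 - \<gamma> (x + j)\<close>, and the expected return time to \<open>0\<close> is a sum of such products.

  Recurrence: the probability \<open>f x\<close> of never entering a positive set \<open>A\<close> is at most \<open>f 0\<close> if
  these products vanish, and \<open>f 0 \<le> f 0 * c\<close> with \<open>c < 1\<close> because \<open>A\<close> is reachable from \<open>0\<close>.
  Transience: if the chain escapes from \<open>0\<close> with probability \<open>q > 0\<close>, the last-exit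
  decomposition bounds the Green function at \<open>0\<close> by \<open>1 / q\<close>. Ergodicity and strong ergodicity:
  \<open>{0}\<close> itself is petite and its mean return time is bounded by comparison with a constant
  multiple of \<open>1 / \<gamma>\<close>.

  For the negative statements an arbitrary petite set \<open>C\<close> has to be excluded. From \<open>C\<close> the chain
  hits \<open>0\<close> within a fixed time with probability bounded below. Hence bounded mean return times to
  \<open>C\<close> give a finite mean return time to \<open>0\<close>, and \<open>C\<close> is bounded when \<open>\<gamma>\<close> vanishes at infinity;
  beyond \<open>C\<close> the chain then climbs for too long.
\<close>

section \<open>Avoidance probabilities\<close>

locale markov_kernel =
  fixes S :: "'a measure" and K :: "'a \<Rightarrow> 'a measure"
  assumes kernel_measurable: "K \<in> S \<rightarrow>\<^sub>M prob_algebra S"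
begin

section \<open>Measurability and total mass of a kernel and its powers\<close>

lemma kernel_measurable_subprob [measurable]: "K \<in> S \<rightarrow>\<^sub>M subprob_algebra S"
  using kernel_measurable by (rule measurable_prob_algebraD)

lemma prob_space_kernel: "x \<in> space S \<Longrightarrow> prob_space (K x)"
  using measurable_space[OF kernel_measurable] by (auto simp: space_prob_algebra)

lemma sets_kernel_eq [simp, measurable_cong]: "x \<in> space S \<Longrightarrow> sets (K x) = sets S"
  using measurable_space[OF kernel_measurable] by (auto simp: space_prob_algebra)

lemma space_kernel_eq [simp]: "x \<in> space S \<Longrightarrow> space (K x) = space S"
  using sets_kernel_eq by (rule sets_eq_imp_space_eq)

lemma emeasure_kernel_space: "x \<in> space S \<Longrightarrow> emeasure (K x) (space S) = 1"
  using prob_space.emeasure_space_1[OF prob_space_kernel] by simp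

lemma nn_integral_kernel_mono:
  assumes "x \<in> space S" "\<And>y. y \<in> space S \<Longrightarrow> f y \<le> g y"
  shows "(\<integral>\<^sup>+y. f y \<partial>K x) \<le> (\<integral>\<^sup>+y. g y \<partial>K x)"
  using assms by (intro nn_integral_mono) simp

lemma kernel_pow_measurable: "kernel_pow S K n \<in> S \<rightarrow>\<^sub>M prob_algebra S"
proof (induction n)
  case 0
  have "kernel_pow S K 0 = return S" by (rule ext) simp
  then show ?case using measurable_return_prob_space by simp
next
  case (Suc n)
  have "kernel_pow S K (Suc n) = (\<lambda>x. K x \<bind> kernel_pow S K n)" by (rule ext) simp
  then show ?case using measurable_bind_prob_space[OF kernel_measurable Suc] by simp
qed

lemma kernel_pow_measurable_subprob [measurable]: "kernel_pow S K n \<in> S \<rightarrow>\<^sub>M subprob_algebra S"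
  using kernel_pow_measurable by (rule measurable_prob_algebraD)

lemma prob_space_kernel_pow: "x \<in> space S \<Longrightarrow> prob_space (kernel_pow S K n x)"
  using measurable_space[OF kernel_pow_measurable] by (auto simp: space_prob_algebra)

lemma sets_kernel_pow [simp]: "x \<in> space S \<Longrightarrow> sets (kernel_pow S K n x) = sets S"
  using measurable_space[OF kernel_pow_measurable] by (auto simp: space_prob_algebra)

lemma emeasure_kernel_pow_measurable [measurable (raw)]:
  assumes [measurable]: "A \<in> sets S"
  shows "(\<lambda>x. emeasure (kernel_pow S K n x) A) \<in> borel_measurable S"
  by measurable

lemma emeasure_kernel_pow_le_1: "x \<in> space S \<Longrightarrow> emeasure (kernel_pow S K n x) A \<le> 1"
  using prob_space.emeasure_le_1[OF prob_space_kernel_pow] .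

lemma emeasure_kernel_pow_Suc:
  assumes "x \<in> space S" "A \<in> sets S"
  shows "emeasure (kernel_pow S K (Suc n) x) A = (\<integral>\<^sup>+y. emeasure (kernel_pow S K n y) A \<partial>K x)"
  using assms emeasure_bind_prob_algebra[OF measurable_space[OF kernel_measurable] kernel_pow_measurable]
  by simp

lemma emeasure_kernel_pow_1:
  assumes "x \<in> space S" "A \<in> sets S"
  shows "emeasure (kernel_pow S K (Suc 0) x) A = emeasure (K x) A"
  using assms by (simp add: emeasure_kernel_pow_Suc del: kernel_pow.simps(2) cong: nn_integral_cong_simp)

text \<open>For the chain started at \<open>x\<close>, \<open>avoid A n x\<close> is the probability of \<open>n < \<tau>\<^sub>A\<close>, where
  \<open>\<tau>\<^sub>A\<close> is the return time; \<open>mean_return A x\<close> is then the tail sum for its expectation.\<close>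

primrec avoid :: "'a set \<Rightarrow> nat \<Rightarrow> 'a \<Rightarrow> ennreal" where
  "avoid A 0 x = 1"
| "avoid A (Suc n) x = (\<integral>\<^sup>+y. indicator (- A) y * avoid A n y \<partial>K x)"

definition mean_return :: "'a set \<Rightarrow> 'a \<Rightarrow> ennreal" where
  "mean_return A x = (\<Sum>n. avoid A n x)"

lemma avoid_measurable [measurable (raw)]:
  assumes [measurable]: "A \<in> sets S"
  shows "avoid A n \<in> borel_measurable S"
proof (induction n)
  case 0
  have "avoid A 0 = (\<lambda>_. 1)" by (rule ext) simp
  then show ?case by simp
next
  case (Suc n)
  note [measurable] = Suc
  have "avoid A (Suc n) = (\<lambda>x. \<integral>\<^sup>+y. indicator (- A) y * avoid A n y \<partial>K x)"
    by (rule ext) simp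
  then show ?case by simp
qed

lemma avoid_Suc_le: "x \<in> space S \<Longrightarrow> avoid A (Suc n) x \<le> avoid A n x"
proof (induction n arbitrary: x)
  case 0
  have "(\<integral>\<^sup>+y. indicator (- A) y \<partial>K x) \<le> (\<integral>\<^sup>+y. 1 \<partial>K x)"
    by (intro nn_integral_mono) (auto split: split_indicator)
  then show ?case using 0 by (simp add: emeasure_kernel_space)
next
  case (Suc n)
  show ?case
    unfolding avoid.simps(2)[of A "Suc n" x] avoid.simps(2)[of A n x]
    using Suc by (intro nn_integral_kernel_mono mult_left_mono) auto
qed

lemma avoid_antimono: "x \<in> space S \<Longrightarrow> m \<le> n \<Longrightarrow> avoid A n x \<le> avoid A m x"
  by (rule lift_Suc_antimono_le[of "\<lambda>n. avoid A n x"]) (rule avoid_Suc_le)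

lemma avoid_le_1: "x \<in> space S \<Longrightarrow> avoid A n x \<le> 1"
  using avoid_antimono[of x 0 n A] by simp

text \<open>Avoiding \<open>A\<close> up to time \<open>n + 1\<close> and being in \<open>A\<close>
  at that time are disjoint events. The locale has no path space, so the proof is an induction on
  the first step. It turns reachability of \<open>A\<close> into an avoidance probability below
  1.\<close>

lemma avoid_plus_hit:
  assumes [measurable]: "A \<in> sets S" and "x \<in> space S"
  shows "avoid A (Suc n) x + emeasure (kernel_pow S K (Suc n) x) A \<le> 1"
  using assms(2)
proof (induction n arbitrary: x)
  case 0
  have "avoid A (Suc 0) x + emeasure (kernel_pow S K (Suc 0) x) A
      = (\<integral>\<^sup>+y. indicator (- A) y \<partial>K x) + (\<integral>\<^sup>+y. indicator A y \<partial>K x)"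
    using 0 by (simp add: emeasure_kernel_pow_1 del: kernel_pow.simps(2))
  also have "\<dots> = (\<integral>\<^sup>+y. indicator (- A) y + indicator A y \<partial>K x)"
    using 0 by (subst nn_integral_add) auto
  also have "\<dots> = (\<integral>\<^sup>+y. 1 \<partial>K x)"
    by (intro nn_integral_cong) (auto split: split_indicator)
  also have "\<dots> = 1" using 0 by (simp add: emeasure_kernel_space)
  finally show ?case by simp
next
  case (Suc n)
  let ?P = "\<lambda>n x. emeasure (kernel_pow S K n x) A"
  have "avoid A (Suc (Suc n)) x + ?P (Suc (Suc n)) x
      = (\<integral>\<^sup>+y. indicator (- A) y * avoid A (Suc n) y + ?P (Suc n) y \<partial>K x)"
    unfolding emeasure_kernel_pow_Suc[OF Suc.prems assms(1), of "Suc n"] avoid.simps(2)[of A "Suc n"]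
    using Suc.prems by (subst nn_integral_add) auto
  also have "\<dots> \<le> (\<integral>\<^sup>+y. 1 \<partial>K x)"
  proof (intro nn_integral_kernel_mono Suc.prems)
    fix y assume y: "y \<in> space S"
    have "indicator (- A) y * avoid A (Suc n) y + ?P (Suc n) y \<le> avoid A (Suc n) y + ?P (Suc n) y"
      by (intro add_right_mono) (auto split: split_indicator)
    also have "\<dots> \<le> 1" by (rule Suc.IH[OF y])
    finally show "indicator (- A) y * avoid A (Suc n) y + ?P (Suc n) y \<le> 1" .
  qed
  also have "\<dots> = 1" using Suc.prems by (simp add: emeasure_kernel_space)
  finally show ?case .
qed

section \<open>First-step analysis: mean return times, drift conditions, limits of avoidance
  probabilities\<close>

lemma mean_return_measurable [measurable (raw)]:
  assumes [measurable]: "A \<in> sets S"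
  shows "mean_return A \<in> borel_measurable S"
proof -
  have "mean_return A = (\<lambda>x. \<Sum>n. avoid A n x)" by (rule ext) (simp add: mean_return_def)
  then show ?thesis by simp
qed

lemma mean_return_step:
  assumes [measurable]: "A \<in> sets S" and x: "x \<in> space S"
  shows "mean_return A x = 1 + (\<integral>\<^sup>+y. indicator (- A) y * mean_return A y \<partial>K x)"
proof -
  have "mean_return A x = avoid A 0 x + (\<Sum>n. avoid A (Suc n) x)"
    unfolding mean_return_def by (subst suminf_offset[of _ 1]) auto
  also have "(\<Sum>n. avoid A (Suc n) x) = (\<integral>\<^sup>+y. (\<Sum>n. indicator (- A) y * avoid A n y) \<partial>K x)"
    using x by (subst nn_integral_suminf) auto
  finally show ?thesis by (simp add: mean_return_def)
qed

text \<open>A Foster-Lyapunov bound: iterating the drift inequality \<open>N\<close> times dominates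
  the first \<open>N\<close> terms of the tail sum. \<open>L\<close> may be infinite, which makes
  the drift condition void at such points.\<close>

lemma mean_return_le_drift:
  assumes [measurable]: "A \<in> sets S"
    and drift: "\<And>x. x \<in> space S \<Longrightarrow> x \<notin> A \<Longrightarrow> 1 + (\<integral>\<^sup>+y. indicator (- A) y * L y \<partial>K x) \<le> L x"
    and x: "x \<in> space S" "x \<notin> A"
  shows "mean_return A x \<le> L x"
proof -
  have "(\<Sum>n<N. avoid A n x) \<le> L x" for N
    using x
  proof (induction N arbitrary: x)
    case 0
    then show ?case by simp
  next
    case (Suc N)
    have "(\<Sum>n<Suc N. avoid A n x) = 1 + (\<Sum>n<N. avoid A (Suc n) x)"
      by (subst sum.lessThan_Suc_shift) simp
    also have "(\<Sum>n<N. avoid A (Suc n) x) = (\<integral>\<^sup>+y. indicator (- A) y * (\<Sum>n<N. avoid A n y) \<partial>K x)"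
      unfolding sum_distrib_left using Suc.prems by (subst nn_integral_sum) auto
    also have "\<dots> \<le> (\<integral>\<^sup>+y. indicator (- A) y * L y \<partial>K x)"
      using Suc by (intro nn_integral_kernel_mono) (auto split: split_indicator)
    finally show ?case using drift[OF Suc.prems] by (meson add_left_mono order_trans)
  qed
  then show ?thesis
    unfolding mean_return_def by (intro suminf_le_const) auto
qed

text \<open>Iterating the inequality \<open>n\<close> times leaves only the paths that have not yet
  entered \<open>A\<close>, on which \<open>f\<close> is still bounded by \<open>c\<close>.\<close>

lemma avoid_le_multiple:
  assumes [measurable]: "A \<in> sets S"
    and le: "\<And>x. x \<in> space S \<Longrightarrow> f x \<le> c"
    and harmonic: "\<And>x. x \<in> space S \<Longrightarrow> f x \<le> (\<integral>\<^sup>+y. indicator (- A) y * f y \<partial>K x)"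
    and x: "x \<in> space S"
  shows "f x \<le> c * avoid A n x"
  using x
proof (induction n arbitrary: x)
  case 0
  then show ?case using le by simp
next
  case (Suc n)
  have "f x \<le> (\<integral>\<^sup>+y. indicator (- A) y * f y \<partial>K x)" by (rule harmonic[OF Suc.prems])
  also have "\<dots> \<le> (\<integral>\<^sup>+y. c * (indicator (- A) y * avoid A n y) \<partial>K x)"
    using Suc by (intro nn_integral_kernel_mono) (auto split: split_indicator)
  also have "\<dots> = c * avoid A (Suc n) x"
    using Suc.prems by (simp add: nn_integral_cmult)
  finally show ?case .
qed

text \<open>The limit of the recursion for \<open>avoid\<close>. The infimum is the probability of
  never returning to \<open>A\<close>, which is thus harmonic for the chain killed on
  \<open>A\<close>.\<close>

lemma INF_avoid_step:
  assumes [measurable]: "A \<in> sets S" and x: "x \<in> space S"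
  shows "(INF n. avoid A n x) = (\<integral>\<^sup>+y. indicator (- A) y * (INF n. avoid A n y) \<partial>K x)"
proof -
  have "(INF n. avoid A n x) = (INF n. avoid A (Suc n) x)"
  proof (rule antisym)
    show "(INF n. avoid A n x) \<le> (INF n. avoid A (Suc n) x)"
      by (rule INF_greatest) (rule INF_lower, simp)
    show "(INF n. avoid A (Suc n) x) \<le> (INF n. avoid A n x)"
      by (rule INF_mono) (use avoid_Suc_le[OF x, of A] in blast)
  qed
  also have "\<dots> = (\<integral>\<^sup>+y. (INF n. indicator (- A) y * avoid A n y) \<partial>K x)"
  proof (subst nn_integral_monotone_convergence_INF_AE')
    show "AE y in K x. indicator (- A) y * avoid A (Suc i) y \<le> indicator (- A) y * avoid A i y" for i
      using x avoid_Suc_le by (intro AE_I2 mult_left_mono) auto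
    show "(\<lambda>y. indicator (- A) y * avoid A i y) \<in> borel_measurable (K x)" for i
      using x by simp
    \<comment> \<open>Monotone convergence for decreasing sequences needs a finite integral; this
      one is \<open>avoid A (Suc 0) x\<close>.\<close>
    show "(\<integral>\<^sup>+y. indicator (- A) y * avoid A 0 y \<partial>K x) < \<infinity>"
      using avoid_le_1[OF x, of A "Suc 0"] by (auto simp: less_top[symmetric] top_unique)
  qed simp
  also have "\<dots> = (\<integral>\<^sup>+y. indicator (- A) y * (INF n. avoid A n y) \<partial>K x)"
    by (intro nn_integral_cong) (auto split: split_indicator)
  finally show ?thesis .
qed

end

section \<open>Return times of a Markov chain\<close>

locale markov_process = markov_kernel S K
  for S :: "'a measure" and K :: "'a \<Rightarrow> 'a measure" +
  fixes PP :: "'a \<Rightarrow> 'w measure" and X :: "nat \<Rightarrow> 'w \<Rightarrow> 'a"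
  assumes chain: "markov_chain S K PP X"
begin

context
  fixes x assumes x: "x \<in> space S"
begin

lemma prob_space_PP: "prob_space (PP x)"
  and X_measurable [measurable]: "X n \<in> PP x \<rightarrow>\<^sub>M S"
  and AE_X_0: "AE \<omega> in PP x. X 0 \<omega> = x"
  and markov_property: "B \<in> past_events S (PP x) X n \<Longrightarrow> A \<in> sets S \<Longrightarrow>
    emeasure (PP x) (B \<inter> X (Suc n) -` A) = (\<integral>\<^sup>+\<omega>\<in>B. emeasure (K (X n \<omega>)) A \<partial>PP x)"
  using chain x by (auto simp: markov_chain_def)

lemma past_events_sigma_algebra: "sigma_algebra (space (PP x)) (past_events S (PP x) X n)"
  unfolding past_events_def by (rule sigma_algebra_sigma_sets) auto

lemma past_events_space: "space (PP x) \<in> past_events S (PP x) X n"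
  unfolding past_events_def by (rule sigma_sets_top)

lemma past_events_sets: "B \<in> past_events S (PP x) X n \<Longrightarrow> B \<in> sets (PP x)"
proof -
  have "sigma_sets (space (PP x)) {X i -` A \<inter> space (PP x) | i A. i \<le> n \<and> A \<in> sets S} \<subseteq> sets (PP x)"
    by (intro sets.sigma_sets_subset) (auto intro: measurable_sets)
  then show "B \<in> past_events S (PP x) X n \<Longrightarrow> B \<in> sets (PP x)"
    by (auto simp: past_events_def)
qed

lemma past_events_coordinate:
  "A \<in> sets S \<Longrightarrow> i \<le> n \<Longrightarrow> X i -` A \<inter> space (PP x) \<in> past_events S (PP x) X n"
  unfolding past_events_def by (rule sigma_sets.Basic) auto

lemma past_events_Suc: "B \<in> past_events S (PP x) X n \<Longrightarrow> B \<in> past_events S (PP x) X (Suc n)"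
proof -
  assume B: "B \<in> past_events S (PP x) X n"
  have "past_events S (PP x) X n \<subseteq> past_events S (PP x) X (Suc n)"
    unfolding past_events_def by (rule sigma_sets_mono') (blast intro: le_SucI)
  with B show ?thesis by auto
qed

lemma past_events_Int:
  "B \<in> past_events S (PP x) X n \<Longrightarrow> C \<in> past_events S (PP x) X n \<Longrightarrow> B \<inter> C \<in> past_events S (PP x) X n"
proof -
  interpret sigma_algebra "space (PP x)" "past_events S (PP x) X n"
    by (rule past_events_sigma_algebra)
  show "B \<in> past_events S (PP x) X n \<Longrightarrow> C \<in> past_events S (PP x) X n \<Longrightarrow> B \<inter> C \<in> past_events S (PP x) X n"
    by (rule Int)
qed

text \<open>Extends the Markov property from indicators to nonnegative measurable functions by an
  identity of measures: restricted to \<open>B\<close>, the law of \<open>X (Suc n)\<close> is the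
  mixture of the kernels \<open>K (X n)\<close>.\<close>

lemma nn_integral_markov_property:
  assumes B: "B \<in> past_events S (PP x) X n" and f [measurable]: "f \<in> borel_measurable S"
  shows "(\<integral>\<^sup>+\<omega>\<in>B. f (X (Suc n) \<omega>) \<partial>PP x) = (\<integral>\<^sup>+\<omega>\<in>B. (\<integral>\<^sup>+y. f y \<partial>K (X n \<omega>)) \<partial>PP x)"
proof -
  note [measurable] = past_events_sets[OF B]
  interpret prob_space "PP x" by (rule prob_space_PP)
  let ?D = "density (PP x) (indicator B)"
  have K_X: "(\<lambda>\<omega>. K (X n \<omega>)) \<in> ?D \<rightarrow>\<^sub>M subprob_algebra S" by simp
  have ne: "space ?D \<noteq> {}" using not_empty by simp
  have eq: "distr ?D S (X (Suc n)) = ?D \<bind> (\<lambda>\<omega>. K (X n \<omega>))"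
  proof (rule measure_eqI)
    show "sets (distr ?D S (X (Suc n))) = sets (?D \<bind> (\<lambda>\<omega>. K (X n \<omega>)))"
      using sets_bind[OF _ ne, of "\<lambda>\<omega>. K (X n \<omega>)" S] K_X subprob_measurableD(2)[OF K_X] by auto
    fix A assume "A \<in> sets (distr ?D S (X (Suc n)))"
    then have [measurable]: "A \<in> sets S" by simp
    have "emeasure (distr ?D S (X (Suc n))) A = emeasure (PP x) (B \<inter> X (Suc n) -` A)"
    proof -
      have "emeasure (distr ?D S (X (Suc n))) A = emeasure ?D (X (Suc n) -` A \<inter> space (PP x))"
        by (subst emeasure_distr) auto
      also have "\<dots> = (\<integral>\<^sup>+\<omega>. indicator B \<omega> * indicator (X (Suc n) -` A \<inter> space (PP x)) \<omega> \<partial>PP x)"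
        by (subst emeasure_density) auto
      also have "\<dots> = (\<integral>\<^sup>+\<omega>. indicator (B \<inter> (X (Suc n) -` A \<inter> space (PP x))) \<omega> \<partial>PP x)"
        by (intro nn_integral_cong) (auto split: split_indicator)
      also have "\<dots> = emeasure (PP x) (B \<inter> (X (Suc n) -` A \<inter> space (PP x)))"
        by (subst nn_integral_indicator) auto
      also have "B \<inter> (X (Suc n) -` A \<inter> space (PP x)) = B \<inter> X (Suc n) -` A"
        using sets.sets_into_space[OF past_events_sets[OF B]] by auto
      finally show ?thesis .
    qed
    also have "\<dots> = (\<integral>\<^sup>+\<omega>\<in>B. emeasure (K (X n \<omega>)) A \<partial>PP x)"
      by (rule markov_property[OF B]) fact
    also have "\<dots> = emeasure (?D \<bind> (\<lambda>\<omega>. K (X n \<omega>))) A"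
      by (subst emeasure_bind[OF ne K_X]) (auto simp: nn_integral_density mult.commute)
    finally show "emeasure (distr ?D S (X (Suc n))) A = emeasure (?D \<bind> (\<lambda>\<omega>. K (X n \<omega>))) A" .
  qed
  have "(\<integral>\<^sup>+\<omega>\<in>B. f (X (Suc n) \<omega>) \<partial>PP x) = (\<integral>\<^sup>+y. f y \<partial>distr ?D S (X (Suc n)))"
    by (subst nn_integral_distr) (auto simp: nn_integral_density mult.commute)
  also have "\<dots> = (\<integral>\<^sup>+\<omega>. (\<integral>\<^sup>+y. f y \<partial>K (X n \<omega>)) \<partial>?D)"
    unfolding eq by (rule nn_integral_bind[OF f K_X])
  also have "\<dots> = (\<integral>\<^sup>+\<omega>\<in>B. (\<integral>\<^sup>+y. f y \<partial>K (X n \<omega>)) \<partial>PP x)"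
    by (subst nn_integral_density) (auto simp: mult.commute)
  finally show ?thesis .
qed

lemma nn_integral_X_0:
  assumes [measurable]: "f \<in> borel_measurable S"
  shows "(\<integral>\<^sup>+\<omega>. f (X 0 \<omega>) \<partial>PP x) = f x"
proof -
  interpret prob_space "PP x" by (rule prob_space_PP)
  have "(\<integral>\<^sup>+\<omega>. f (X 0 \<omega>) \<partial>PP x) = (\<integral>\<^sup>+\<omega>. f x \<partial>PP x)"
    using AE_X_0 by (intro nn_integral_cong_AE) auto
  then show ?thesis by (simp add: emeasure_space_1)
qed

text \<open>Induction on \<open>k\<close> for all \<open>n\<close> and \<open>B\<close> at once: the
  event that the next state misses \<open>A\<close> is absorbed into the past event, and one use of
  the Markov property turns \<open>avoid A k\<close> into \<open>avoid A (Suc k)\<close>.\<close>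

lemma emeasure_avoid_past:
  assumes [measurable]: "A \<in> sets S" and B: "B \<in> past_events S (PP x) X n"
  shows "emeasure (PP x) {\<omega>\<in>B. \<forall>i<k. X (Suc (n + i)) \<omega> \<notin> A} = (\<integral>\<^sup>+\<omega>\<in>B. avoid A k (X n \<omega>) \<partial>PP x)"
  using B
proof (induction k arbitrary: n B)
  case 0
  note [measurable] = past_events_sets[OF 0]
  show ?case by simp
next
  case (Suc k)
  note [measurable] = past_events_sets[OF Suc.prems]
  let ?C = "X (Suc n) -` (space S - A) \<inter> space (PP x)"
  have BC: "B \<inter> ?C \<in> past_events S (PP x) X (Suc n)"
    by (intro past_events_Int past_events_coordinate past_events_Suc Suc.prems) auto
  have "{\<omega>\<in>B. \<forall>i<Suc k. X (Suc (n + i)) \<omega> \<notin> A}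
      = {\<omega>\<in>B \<inter> ?C. \<forall>i<k. X (Suc (Suc n + i)) \<omega> \<notin> A}"
    using sets.sets_into_space[OF past_events_sets[OF Suc.prems]] measurable_space[OF X_measurable]
    by (auto simp: less_Suc_eq_0_disj)
  then have "emeasure (PP x) {\<omega>\<in>B. \<forall>i<Suc k. X (Suc (n + i)) \<omega> \<notin> A}
      = (\<integral>\<^sup>+\<omega>\<in>B \<inter> ?C. avoid A k (X (Suc n) \<omega>) \<partial>PP x)"
    using Suc.IH[OF BC] by simp
  also have "\<dots> = (\<integral>\<^sup>+\<omega>\<in>B. indicator (- A) (X (Suc n) \<omega>) * avoid A k (X (Suc n) \<omega>) \<partial>PP x)"
    using measurable_space[OF X_measurable]
    by (intro nn_integral_cong) (auto split: split_indicator)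
  also have "\<dots> = (\<integral>\<^sup>+\<omega>\<in>B. avoid A (Suc k) (X n \<omega>) \<partial>PP x)"
    unfolding avoid.simps by (rule nn_integral_markov_property[OF Suc.prems]) simp
  finally show ?case .
qed

lemma emeasure_avoid:
  assumes [measurable]: "A \<in> sets S"
  shows "emeasure (PP x) {\<omega>\<in>space (PP x). \<forall>i<k. X (Suc i) \<omega> \<notin> A} = avoid A k x"
proof -
  have "emeasure (PP x) {\<omega>\<in>space (PP x). \<forall>i<k. X (Suc i) \<omega> \<notin> A}
      = (\<integral>\<^sup>+\<omega>\<in>space (PP x). avoid A k (X 0 \<omega>) \<partial>PP x)"
    using emeasure_avoid_past[OF assms past_events_space, where n = 0 and k = k] by (simp only: add_0_left)
  also have "\<dots> = (\<integral>\<^sup>+\<omega>. avoid A k (X 0 \<omega>) \<partial>PP x)"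
    by (intro nn_integral_cong) auto
  also have "\<dots> = avoid A k x" by (rule nn_integral_X_0) simp
  finally show ?thesis .
qed

text \<open>The integral of \<open>P^k(X m, A)\<close> does not change when \<open>k\<close> drops
  by one and \<open>m\<close> rises by one, so the whole kernel power can be moved onto the
  path.\<close>

lemma emeasure_X:
  assumes [measurable]: "A \<in> sets S"
  shows "emeasure (PP x) (X n -` A \<inter> space (PP x)) = emeasure (kernel_pow S K n x) A"
proof -
  have "(\<integral>\<^sup>+\<omega>. emeasure (kernel_pow S K k (X m \<omega>)) A \<partial>PP x)
      = emeasure (PP x) (X (m + k) -` A \<inter> space (PP x))" for m k
  proof (induction k arbitrary: m)
    case 0
    have "(\<integral>\<^sup>+\<omega>. emeasure (kernel_pow S K 0 (X m \<omega>)) A \<partial>PP x)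
        = (\<integral>\<^sup>+\<omega>. indicator (X m -` A \<inter> space (PP x)) \<omega> \<partial>PP x)"
      by (intro nn_integral_cong) (auto split: split_indicator)
    then show ?case by simp
  next
    case (Suc k)
    have "(\<integral>\<^sup>+\<omega>. emeasure (kernel_pow S K (Suc k) (X m \<omega>)) A \<partial>PP x)
        = (\<integral>\<^sup>+\<omega>\<in>space (PP x). (\<integral>\<^sup>+y. emeasure (kernel_pow S K k y) A \<partial>K (X m \<omega>)) \<partial>PP x)"
      using measurable_space[OF X_measurable]
      by (intro nn_integral_cong) (simp add: emeasure_kernel_pow_Suc del: kernel_pow.simps(2))
    also have "\<dots> = (\<integral>\<^sup>+\<omega>\<in>space (PP x). emeasure (kernel_pow S K k (X (Suc m) \<omega>)) A \<partial>PP x)"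
      by (rule nn_integral_markov_property[symmetric, OF past_events_space]) simp
    also have "\<dots> = (\<integral>\<^sup>+\<omega>. emeasure (kernel_pow S K k (X (Suc m) \<omega>)) A \<partial>PP x)"
      by (intro nn_integral_cong) auto
    also have "\<dots> = emeasure (PP x) (X (m + Suc k) -` A \<inter> space (PP x))"
      using Suc[of "Suc m"] by simp
    finally show ?case .
  qed
  from this[of n 0] show ?thesis
    using nn_integral_X_0[of "\<lambda>y. emeasure (kernel_pow S K n y) A"] by simp
qed

text \<open>The return time counts from time 1, so exceeding \<open>n\<close> constrains
  \<open>X 1, ..., X n\<close>. The infimum over the empty set is infinite, which covers paths that
  never return.\<close>

lemma less_return_time_iff: "enat n < return_time X A \<omega> \<longleftrightarrow> (\<forall>i<n. X (Suc i) \<omega> \<notin> A)"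
proof -
  have "enat n < return_time X A \<omega> \<longleftrightarrow> enat (Suc n) \<le> return_time X A \<omega>"
    by (rule Suc_ile_eq[symmetric])
  also have "\<dots> \<longleftrightarrow> (\<forall>m. 1 \<le> m \<and> X m \<omega> \<in> A \<longrightarrow> Suc n \<le> m)"
    by (auto simp: return_time_def le_INF_iff)
  also have "\<dots> \<longleftrightarrow> (\<forall>i<n. X (Suc i) \<omega> \<notin> A)"
  proof safe
    fix m assume "\<forall>i<n. X (Suc i) \<omega> \<notin> A" "1 \<le> m" "X m \<omega> \<in> A"
    then show "Suc n \<le> m" by (cases m) (auto simp: less_Suc_eq_le not_less[symmetric] simp del: not_less)
  qed auto
  finally show ?thesis .
qed

text \<open>An extended natural is determined by the naturals below it, so each fibre is a countable
  intersection of avoidance events and complements of such events.\<close>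

lemma return_time_measurable [measurable]:
  assumes [measurable]: "A \<in> sets S"
  shows "return_time X A \<in> PP x \<rightarrow>\<^sub>M count_space UNIV"
proof -
  have "{\<omega>\<in>space (PP x). return_time X A \<omega> = t} \<in> sets (PP x)" for t
  proof -
    have "return_time X A \<omega> = t \<longleftrightarrow> (\<forall>n. (enat n < t) = (\<forall>i<n. X (Suc i) \<omega> \<notin> A))" for \<omega>
      unfolding less_return_time_iff[symmetric]
    proof safe
      assume *: "\<forall>n. (enat n < t) = (enat n < return_time X A \<omega>)"
      show "return_time X A \<omega> = t"
      proof (cases "return_time X A \<omega>" t rule: linorder_cases)
        case less
        then obtain k where "return_time X A \<omega> = enat k" by (cases "return_time X A \<omega>") auto
        then show ?thesis using * less by auto
      next
        case greater
        then obtain k where "t = enat k" by (cases t) auto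
        then show ?thesis using * greater by auto
      qed
    qed
    then show ?thesis by simp
  qed
  then show ?thesis
    by (intro measurable_count_space_eq_countable[THEN iffD2]) (auto simp: vimage_def Int_def conj_commute)
qed

lemma nn_integral_return_time:
  assumes [measurable]: "A \<in> sets S"
  shows "(\<integral>\<^sup>+\<omega>. ennreal_of_enat (return_time X A \<omega>) \<partial>PP x) = mean_return A x"
  by (subst nn_integral_enat_function) (auto simp: less_return_time_iff emeasure_avoid mean_return_def)

text \<open>Summation by tails based on \<open>r ^ t - 1 = (r - 1) * (\<Sum>n<t. r ^ n)\<close>;
  dropping the \<open>- 1\<close> leaves an inequality. Where the return time is infinite, so is the
  integrand on the right.\<close>

lemma power_return_time_ge:
  assumes [measurable]: "A \<in> sets S" and r: "r > 1"
  shows "ennreal (r - 1) * (\<Sum>n. ennreal (r ^ n) * avoid A n x) \<le>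
    (\<integral>\<^sup>+\<omega>. power_enat r (return_time X A \<omega>) \<partial>PP x)"
proof -
  have pointwise: "ennreal (r - 1) * (\<Sum>n. ennreal (r ^ n) * indicator {n. enat n < t} n) \<le> power_enat r t" for t
  proof (cases t)
    case (enat k)
    have "(\<Sum>n. ennreal (r ^ n) * indicator {n. enat n < t} n) = (\<Sum>n<k. ennreal (r ^ n))"
      by (subst suminf_finite[of "{..<k}"]) (auto simp: enat)
    also have "\<dots> = ennreal (\<Sum>n<k. r ^ n)"
      using r by (intro sum_ennreal) auto
    also have "ennreal (r - 1) * \<dots> = ennreal (r ^ k - 1)"
      using r by (subst ennreal_mult[symmetric]) (auto simp: power_diff_1_eq sum_nonneg)
    also have "\<dots> \<le> ennreal (r ^ k)" by (intro ennreal_leI) simp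
    finally show ?thesis by (simp add: enat power_enat_def)
  qed (simp add: power_enat_def)
  have "ennreal (r - 1) * (\<Sum>n. ennreal (r ^ n) * avoid A n x)
      = ennreal (r - 1) * (\<Sum>n. \<integral>\<^sup>+\<omega>. ennreal (r ^ n) *
          indicator {\<omega>\<in>space (PP x). \<forall>i<n. X (Suc i) \<omega> \<notin> A} \<omega> \<partial>PP x)"
    by (simp add: nn_integral_cmult emeasure_avoid)
  also have "\<dots> = (\<integral>\<^sup>+\<omega>. ennreal (r - 1) * (\<Sum>n. ennreal (r ^ n) *
          indicator {\<omega>\<in>space (PP x). \<forall>i<n. X (Suc i) \<omega> \<notin> A} \<omega>) \<partial>PP x)"
    by (simp add: nn_integral_cmult nn_integral_suminf)
  also have "\<dots> \<le> (\<integral>\<^sup>+\<omega>. power_enat r (return_time X A \<omega>) \<partial>PP x)"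
  proof (intro nn_integral_mono)
    fix \<omega> assume \<omega>: "\<omega> \<in> space (PP x)"
    have "indicator {\<omega>\<in>space (PP x). \<forall>i<n. X (Suc i) \<omega> \<notin> A} \<omega>
        = (indicator {n. enat n < return_time X A \<omega>} n :: ennreal)" for n
      using \<omega> by (auto simp: less_return_time_iff split: split_indicator)
    then show "ennreal (r - 1) * (\<Sum>n. ennreal (r ^ n) *
        indicator {\<omega>\<in>space (PP x). \<forall>i<n. X (Suc i) \<omega> \<notin> A} \<omega>) \<le> power_enat r (return_time X A \<omega>)"
      using pointwise[of "return_time X A \<omega>"] by simp
  qed
  finally show ?thesis .
qed

text \<open>The Markov property at time \<open>m\<close> bounds the probability of no visit after
  \<open>m\<close> by the mean of \<open>avoid A k (X m)\<close> for every \<open>k\<close>, which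
  tends to 0. Discarding one null set for each \<open>m\<close> leaves paths with infinitely many
  visits.\<close>

lemma prob_infinitely_often:
  assumes [measurable]: "A \<in> sets S"
    and lim: "\<And>y. y \<in> space S \<Longrightarrow> (INF n. avoid A n y) = 0"
  shows "\<P>(\<omega> in PP x. (\<Sum>n. indicator A (X (Suc n) \<omega>)) = (\<infinity> :: ennreal)) = 1"
proof -
  interpret prob_space "PP x" by (rule prob_space_PP)
  have null: "AE \<omega> in PP x. \<exists>i. X (Suc (m + i)) \<omega> \<in> A" for m
  proof -
    let ?N = "{\<omega>\<in>space (PP x). \<forall>i. X (Suc (m + i)) \<omega> \<notin> A}"
    have "emeasure (PP x) ?N \<le> (\<integral>\<^sup>+\<omega>. avoid A k (X m \<omega>) \<partial>PP x)" for k
    proof -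
      have "emeasure (PP x) ?N \<le> emeasure (PP x) {\<omega>\<in>space (PP x). \<forall>i<k. X (Suc (m + i)) \<omega> \<notin> A}"
        by (intro emeasure_mono) auto
      also have "\<dots> = (\<integral>\<^sup>+\<omega>\<in>space (PP x). avoid A k (X m \<omega>) \<partial>PP x)"
        by (rule emeasure_avoid_past[OF assms(1) past_events_space])
      also have "\<dots> = (\<integral>\<^sup>+\<omega>. avoid A k (X m \<omega>) \<partial>PP x)"
        by (intro nn_integral_cong) auto
      finally show ?thesis .
    qed
    then have "emeasure (PP x) ?N \<le> (INF k. \<integral>\<^sup>+\<omega>. avoid A k (X m \<omega>) \<partial>PP x)"
      by (intro INF_greatest)
    also have "\<dots> = (\<integral>\<^sup>+\<omega>. (INF k. avoid A k (X m \<omega>)) \<partial>PP x)"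
      using measurable_compose[OF X_measurable avoid_measurable[OF assms(1)]]
      using measurable_space[OF X_measurable] avoid_Suc_le
      by (intro nn_integral_monotone_convergence_INF_AE'[symmetric]) (auto simp: emeasure_space_1)
    also have "\<dots> = (\<integral>\<^sup>+\<omega>. 0 \<partial>PP x)"
      using lim measurable_space[OF X_measurable] by (intro nn_integral_cong) auto
    finally show ?thesis
      by (intro AE_I[of _ _ ?N]) auto
  qed
  then have "AE \<omega> in PP x. \<forall>m. \<exists>i. X (Suc (m + i)) \<omega> \<in> A"
    by (simp add: AE_all_countable)
  then have "AE \<omega> in PP x. (\<Sum>n. indicator A (X (Suc n) \<omega>)) = (\<infinity> :: ennreal)"
  proof eventually_elim
    case (elim \<omega>)
    let ?u = "\<lambda>n. indicator A (X (Suc n) \<omega>) :: ennreal"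
    have inf: "infinite {n. X (Suc n) \<omega> \<in> A}"
      unfolding infinite_nat_iff_unbounded_le
    proof
      fix m
      obtain i where "X (Suc (m + i)) \<omega> \<in> A" using elim by blast
      then show "\<exists>n\<ge>m. n \<in> {n. X (Suc n) \<omega> \<in> A}" by (intro exI[of _ "m + i"]) auto
    qed
    have "of_nat N \<le> (\<Sum>n. ?u n)" for N
    proof -
      obtain T where T: "T \<subseteq> {n. X (Suc n) \<omega> \<in> A}" "finite T" "card T = N"
        using infinite_arbitrarily_large[OF inf] by metis
      have "(of_nat N :: ennreal) = (\<Sum>n\<in>T. ?u n)"
        using T by (subst sum.cong[of T T _ "\<lambda>_. 1"]) auto
      also have "\<dots> \<le> (\<Sum>n. ?u n)" by (intro sum_le_suminf T) auto
      finally show ?thesis .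
    qed
    then show ?case
      by (metis ennreal_Ex_less_of_nat infinity_ennreal_def less_top not_le)
  qed
  then show ?thesis
    by (intro prob_Collect_eq_1[THEN iffD2]) auto
qed

text \<open>Last-exit decomposition: the events that \<open>n\<close> is the last visit to \<open>z\<close> are disjoint.\<close>

lemma green_function_le:
  assumes z [measurable]: "{z} \<in> sets S"
    and q: "\<And>k. q \<le> avoid {z} k z"
  shows "(\<Sum>n. emeasure (kernel_pow S K n x) {z}) * q \<le> 1"
proof -
  interpret prob_space "PP x" by (rule prob_space_PP)
  have "(\<Sum>n<N. emeasure (kernel_pow S K n x) {z}) * q \<le> 1" for N
  proof -
    define V where "V n = X n -` {z} \<inter> space (PP x)" for n
    \<comment> \<open>Here \<open>n\<close> is the last visit to \<open>z\<close> up to time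
      \<open>N\<close>: the window \<open>i < N - n\<close> covers the times
      \<open>n + 1, ..., N\<close>.\<close>
    define E where "E n = {\<omega>\<in>V n. \<forall>i<N-n. X (Suc (n + i)) \<omega> \<notin> {z}}" for n
    have V: "V n \<in> past_events S (PP x) X n" for n
      unfolding V_def by (rule past_events_coordinate[OF z]) simp
    note [measurable] = past_events_sets[OF V]
    have E [measurable]: "E n \<in> sets (PP x)" for n
    proof -
      have "E n = V n \<inter> {\<omega>\<in>space (PP x). \<forall>i<N-n. X (Suc (n + i)) \<omega> \<notin> {z}}"
        by (auto simp: E_def V_def)
      then show ?thesis by simp
    qed
    have disj: "disjoint_family_on E {..<N}"
    proof -
      have "E m \<inter> E n = {}" if "m < n" "n < N" for m n
      proof -
        have "X n \<omega> \<noteq> z" if "\<omega> \<in> E m" for \<omega>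
        proof -
          have "\<forall>i<N-m. X (Suc (m + i)) \<omega> \<noteq> z" using that by (simp add: E_def)
          from this[rule_format, of "n - Suc m"] show ?thesis using \<open>m < n\<close> \<open>n < N\<close> by simp
        qed
        then show ?thesis by (auto simp: E_def V_def)
      qed
      then show ?thesis
        unfolding disjoint_family_on_def by (metis Int_commute lessThan_iff linorder_neqE_nat)
    qed
    have "emeasure (kernel_pow S K n x) {z} * q \<le> emeasure (PP x) (E n)" for n
    proof -
      have "emeasure (kernel_pow S K n x) {z} * q = (\<integral>\<^sup>+\<omega>. q * indicator (V n) \<omega> \<partial>PP x)"
        by (simp add: nn_integral_cmult emeasure_X[symmetric] V_def[symmetric] mult.commute)
      also have "\<dots> \<le> (\<integral>\<^sup>+\<omega>\<in>V n. avoid {z} (N - n) (X n \<omega>) \<partial>PP x)"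
        using q by (intro nn_integral_mono) (auto simp: V_def split: split_indicator)
      also have "\<dots> = emeasure (PP x) (E n)"
        unfolding E_def by (rule emeasure_avoid_past[OF z V, symmetric])
      finally show ?thesis .
    qed
    then have "(\<Sum>n<N. emeasure (kernel_pow S K n x) {z}) * q \<le> (\<Sum>n<N. emeasure (PP x) (E n))"
      by (simp add: sum_distrib_right sum_mono)
    also have "\<dots> = emeasure (PP x) (\<Union>n<N. E n)"
      using disj by (intro sum_emeasure) auto
    also have "\<dots> \<le> 1" by (rule emeasure_le_1)
    finally show ?thesis .
  qed
  then have "(\<Sum>n. emeasure (kernel_pow S K n x) {z} * q) \<le> 1"
    by (intro suminf_le_const) (auto simp: sum_distrib_right)
  then show ?thesis by simp
qed

end

end

section \<open>The jump chain\<close>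

locale jump_chain =
  fixes \<gamma> \<beta> :: "real \<Rightarrow> real"
  assumes \<gamma>_cont: "continuous_on {0..} \<gamma>"
    and \<gamma>_bounds: "\<And>x. x \<ge> 0 \<Longrightarrow> 0 < \<gamma> x \<and> \<gamma> x < 1"
    and \<beta>_meas [measurable]: "\<beta> \<in> borel_measurable borel"
    and \<beta>_nonneg: "\<And>x. 0 \<le> \<beta> x"
    and \<beta>_density: "(\<integral>\<^sup>+x. ennreal (\<beta> x) \<partial>lborel) = 1"
    and \<beta>_zero: "\<And>x. x \<le> 0 \<Longrightarrow> \<beta> x = 0"
begin

section \<open>Integrals against the jump kernel\<close>

lemma \<gamma>_pos: "x \<ge> 0 \<Longrightarrow> 0 < \<gamma> x" and \<gamma>_less_1: "x \<ge> 0 \<Longrightarrow> \<gamma> x < 1"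
  using \<gamma>_bounds by auto

lemma \<gamma>_measurable [measurable]: "\<gamma> \<in> borel_measurable half_line"
  unfolding half_line_def by (rule borel_measurable_continuous_on_restrict[OF \<gamma>_cont])

lemma ident_measurable [measurable]: "(\<lambda>x. x) \<in> borel_measurable half_line"
  unfolding half_line_def by (rule measurable_restrict_space1) simp

lemma zero_sets [measurable, simp]: "{0} \<in> sets half_line"
  by (auto simp: half_line_def sets_restrict_space image_iff intro!: bexI[of _ "{0}"])

lemma plus_1_measurable [measurable]: "(\<lambda>x. x + 1) \<in> half_line \<rightarrow>\<^sub>M half_line"
  unfolding half_line_def
  by (rule measurable_restrict_space3) auto

lemma nn_integral_jump_kernel_0:
  assumes [measurable]: "f \<in> borel_measurable half_line"
  shows "(\<integral>\<^sup>+y. f y \<partial>jump_kernel \<gamma> \<beta> 0) = (\<integral>\<^sup>+y\<in>{0<..}. ennreal (\<beta> y) * f y \<partial>lborel)"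
proof -
  have sets_eq: "sets (restrict_space lborel {0..}) = sets half_line"
    unfolding half_line_def by (rule sets_restrict_space_cong) simp
  have f: "f \<in> borel_measurable (restrict_space lborel {0..})"
    using assms by (simp add: measurable_cong_sets[OF sets_eq refl])
  have "(\<integral>\<^sup>+y. f y \<partial>jump_kernel \<gamma> \<beta> 0) = (\<integral>\<^sup>+y. ennreal (\<beta> y) * f y \<partial>restrict_space lborel {0..})"
    unfolding jump_kernel_def using f
    by (simp add: nn_integral_density measurable_restrict_space1)
  also have "\<dots> = (\<integral>\<^sup>+y\<in>{0..}. ennreal (\<beta> y) * f y \<partial>lborel)"
    by (subst nn_integral_restrict_space) auto
  also have "\<dots> = (\<integral>\<^sup>+y\<in>{0<..}. ennreal (\<beta> y) * f y \<partial>lborel)"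
    using \<beta>_zero[of 0] by (intro nn_integral_cong) (auto split: split_indicator simp: less_le)
  finally show ?thesis .
qed

lemma nn_integral_\<beta>: "(\<integral>\<^sup>+y\<in>{0<..}. ennreal (\<beta> y) \<partial>lborel) = 1"
proof -
  have "(\<integral>\<^sup>+y\<in>{0<..}. ennreal (\<beta> y) \<partial>lborel) = (\<integral>\<^sup>+y. ennreal (\<beta> y) \<partial>lborel)"
    using \<beta>_zero by (intro nn_integral_cong) (auto split: split_indicator)
  then show ?thesis using \<beta>_density by simp
qed

text \<open>Otherwise \<open>\<beta> y * h y\<close> vanishes almost everywhere. As \<open>h\<close>
  is positive wherever \<beta> can be nonzero, \<beta> itself would vanish almost everywhere,
  against its total mass 1.\<close>

lemma nn_integral_\<beta>_pos:
  fixes h :: "real \<Rightarrow> ennreal"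
  assumes h: "h \<in> borel_measurable half_line" and pos: "\<And>y. y > 0 \<Longrightarrow> h y > 0"
  shows "0 < (\<integral>\<^sup>+y\<in>{0<..}. ennreal (\<beta> y) * h y \<partial>lborel)"
proof (rule ccontr)
  assume "\<not> ?thesis"
  moreover have "(\<integral>\<^sup>+y\<in>{0<..}. ennreal (\<beta> y) * h y \<partial>lborel)
      = (\<integral>\<^sup>+y. ennreal (\<beta> y) * (h y * indicator {0..} y) \<partial>lborel)"
    using \<beta>_zero[of 0] by (intro nn_integral_cong) (auto split: split_indicator simp: less_le)
  ultimately have 0: "(\<integral>\<^sup>+y. ennreal (\<beta> y) * (h y * indicator {0..} y) \<partial>lborel) = 0"
    by (simp add: zero_less_iff_neq_zero)
  \<comment> \<open>\<open>h\<close> is only known to be measurable on the half-line; cut off by the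
    indicator it is Borel on the whole line.\<close>
  have [measurable]: "(\<lambda>y. h y * indicator {0..} y) \<in> borel_measurable borel"
    using borel_measurable_restrict_space_iff_ennreal[of "{0..}" borel h] h
    by (simp add: half_line_def)
  have "AE y in lborel. ennreal (\<beta> y) * (h y * indicator {0..} y) = 0"
    using 0 by (subst (asm) nn_integral_0_iff_AE) auto
  then have "AE y in lborel. ennreal (\<beta> y) = 0"
  proof eventually_elim
    case (elim y)
    then show ?case
      using \<beta>_zero[of y] pos[of y] by (cases "y \<le> 0") (auto simp: not_le)
  qed
  then have "(\<integral>\<^sup>+y. ennreal (\<beta> y) \<partial>lborel) = 0"
    by (subst nn_integral_0_iff_AE) auto
  then show False using \<beta>_density by simp
qed

text \<open>The kernel is identified with the image of a Bernoulli law, whose integrals are two-term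
  sums.\<close>

lemma nn_integral_jump_kernel_pos:
  assumes x: "x > 0" and f [measurable]: "f \<in> borel_measurable half_line"
  shows "(\<integral>\<^sup>+y. f y \<partial>jump_kernel \<gamma> \<beta> x) = ennreal (\<gamma> x) * f 0 + ennreal (1 - \<gamma> x) * f (x + 1)"
proof -
  let ?b = "\<lambda>b. if b then 0 else x + 1"
  let ?M = "distr (bernoulli_pmf (\<gamma> x)) half_line ?b"
  have \<gamma>: "0 \<le> \<gamma> x" "\<gamma> x \<le> 1" using \<gamma>_bounds[of x] x by auto
  have b: "?b \<in> measure_pmf (bernoulli_pmf (\<gamma> x)) \<rightarrow>\<^sub>M half_line"
    using x by (auto simp: measurable_pmf_measure1)
  have int: "(\<integral>\<^sup>+y. h y \<partial>?M) = ennreal (\<gamma> x) * h 0 + ennreal (1 - \<gamma> x) * h (x + 1)"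
    if "h \<in> borel_measurable half_line" for h
    using \<gamma> that b by (subst nn_integral_distr) (auto simp: mult.commute)
  have "jump_kernel \<gamma> \<beta> x = ?M"
  proof (rule measure_eqI)
    fix A assume "A \<in> sets (jump_kernel \<gamma> \<beta> x)"
    then have A: "A \<in> sets half_line" by simp
    have "emeasure ?M A = (\<integral>\<^sup>+y. indicator A y \<partial>?M)" using A by simp
    also have "\<dots> = ennreal (\<gamma> x) * indicator A 0 + ennreal (1 - \<gamma> x) * indicator A (x + 1)"
      using A by (intro int) simp
    finally show "emeasure (jump_kernel \<gamma> \<beta> x) A = emeasure ?M A"
      using emeasure_jump_kernel_pos[OF x A] by simp
  qed simp
  then show ?thesis using int[OF f] by simp
qed

lemma jump_kernel_measurable: "jump_kernel \<gamma> \<beta> \<in> half_line \<rightarrow>\<^sub>M prob_algebra half_line"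
proof (rule measurable_prob_algebraI)
  show prob: "prob_space (jump_kernel \<gamma> \<beta> x)" if "x \<in> space half_line" for x
  proof
    have sp: "space (jump_kernel \<gamma> \<beta> x) = space half_line"
      by (rule sets_eq_imp_space_eq) simp
    have "emeasure (jump_kernel \<gamma> \<beta> x) (space (jump_kernel \<gamma> \<beta> x)) = (\<integral>\<^sup>+y. 1 \<partial>jump_kernel \<gamma> \<beta> x)"
      by simp
    also have "\<dots> = 1"
    proof (cases "x = 0")
      case True
      then show ?thesis
        using nn_integral_jump_kernel_0[of "\<lambda>_. 1"] nn_integral_\<beta> by simp
    next
      case False
      then have x: "x > 0" using that by simp
      then show ?thesis
        using nn_integral_jump_kernel_pos[of x "\<lambda>_. 1"] \<gamma>_bounds[of x]
        by (simp add: ennreal_plus[symmetric] del: ennreal_plus)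
    qed
    finally show "emeasure (jump_kernel \<gamma> \<beta> x) (space (jump_kernel \<gamma> \<beta> x)) = 1" .
  qed
  show "jump_kernel \<gamma> \<beta> \<in> half_line \<rightarrow>\<^sub>M subprob_algebra half_line"
  proof (rule measurable_subprob_algebra)
    fix A assume A [measurable]: "A \<in> sets half_line"
    have "(\<lambda>x. if x \<in> {0} then emeasure (jump_kernel \<gamma> \<beta> 0) A
        else ennreal (\<gamma> x) * indicator A 0 + ennreal (1 - \<gamma> x) * indicator A (x + 1)) \<in> borel_measurable half_line"
      by (rule measurable_If_set) auto
    then show "(\<lambda>x. emeasure (jump_kernel \<gamma> \<beta> x) A) \<in> borel_measurable half_line"
      by (rule measurable_cong[THEN iffD1, rotated]) (use A in \<open>auto simp: emeasure_jump_kernel_pos\<close>)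
  qed (use prob prob_space_imp_subprob_space in auto)
qed

sublocale markov_kernel half_line "jump_kernel \<gamma> \<beta>"
  by unfold_locales (rule jump_kernel_measurable)

section \<open>Survival products along the orbit x, x + 1, x + 2, ..\<close>

definition survive :: "nat \<Rightarrow> real \<Rightarrow> real" where
  "survive n x = (\<Prod>j<n. 1 - \<gamma> (x + real j))"

lemma survive_0 [simp]: "survive 0 x = 1"
  by (simp add: survive_def)

lemma survive_Suc: "survive (Suc n) x = (1 - \<gamma> x) * survive n (x + 1)"
  unfolding survive_def by (subst prod.lessThan_Suc_shift) (simp add: add.assoc)

lemma survive_Suc_right: "survive (Suc n) x = survive n x * (1 - \<gamma> (x + real n))"
  by (simp add: survive_def)

lemma survive_add: "survive (m + n) x = survive m x * survive n (x + real m)"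
  by (induction n) (simp_all add: survive_Suc_right algebra_simps)

lemma survive_pos: "x \<ge> 0 \<Longrightarrow> survive n x > 0"
  unfolding survive_def using \<gamma>_less_1 by (intro prod_pos) auto

lemma survive_nonneg: "x \<ge> 0 \<Longrightarrow> survive n x \<ge> 0"
  using survive_pos[of x n] by simp

lemma survive_le_1: "x \<ge> 0 \<Longrightarrow> survive n x \<le> 1"
  unfolding survive_def using \<gamma>_bounds by (intro prod_le_1) (auto simp: less_imp_le)

lemma survive_antimono: "x \<ge> 0 \<Longrightarrow> m \<le> n \<Longrightarrow> survive n x \<le> survive m x"
  using survive_add[of m "n - m" x] survive_le_1[of "x + real m" "n - m"] survive_nonneg[of x m]
  by (simp add: mult_left_le)

lemma survive_ge_power:
  assumes "x \<ge> 0" "\<eta> \<le> 1" "\<And>y. y \<ge> x \<Longrightarrow> \<gamma> y \<le> \<eta>"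
  shows "(1 - \<eta>) ^ n \<le> survive n x"
proof -
  have "(1 - \<eta>) ^ n = (\<Prod>j<n. 1 - \<eta>)" by simp
  also have "\<dots> \<le> survive n x"
    unfolding survive_def using assms by (intro prod_mono) auto
  finally show ?thesis .
qed

lemma survive_le_power:
  assumes "x \<ge> 0" "\<And>y. y \<ge> x \<Longrightarrow> \<gamma> y \<ge> \<eta>"
  shows "survive n x \<le> (1 - \<eta>) ^ n"
proof -
  have "survive n x \<le> (\<Prod>j<n. 1 - \<eta>)"
    unfolding survive_def using assms \<gamma>_less_1 by (intro prod_mono) (auto simp: less_imp_le)
  then show ?thesis by simp
qed

lemma survive_measurable [measurable]: "survive n \<in> borel_measurable half_line"
proof (induction n)
  case 0
  have "survive 0 = (\<lambda>_. 1)" by (rule ext) simp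
  then show ?case by simp
next
  case (Suc n)
  have [measurable]: "(\<lambda>x. survive n (x + 1)) \<in> borel_measurable half_line"
    using measurable_compose[OF plus_1_measurable Suc] .
  have "survive (Suc n) = (\<lambda>x. (1 - \<gamma> x) * survive n (x + 1))"
    by (rule ext) (rule survive_Suc)
  then show ?case by simp
qed

lemma avoid_Suc_pos:
  assumes x: "x > 0" and [measurable]: "A \<in> sets half_line"
  shows "avoid A (Suc n) x = ennreal (\<gamma> x) * (indicator (- A) 0 * avoid A n 0)
    + ennreal (1 - \<gamma> x) * (indicator (- A) (x + 1) * avoid A n (x + 1))"
  unfolding avoid.simps by (rule nn_integral_jump_kernel_pos[OF x]) simp

text \<open>From a positive state only the uninterrupted climb avoids 0, so the jump term of the
  recursion drops out.\<close>

lemma avoid_zero: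
  assumes "x > 0"
  shows "avoid {0} n x = ennreal (survive n x)"
  using assms
proof (induction n arbitrary: x)
  case (Suc n)
  then have "avoid {0} (Suc n) x = ennreal (1 - \<gamma> x) * ennreal (survive n (x + 1))"
    by (simp add: avoid_Suc_pos del: avoid.simps)
  also have "\<dots> = ennreal (survive (Suc n) x)"
    using Suc.prems \<gamma>_less_1[of x] survive_nonneg[of "x + 1" n]
    by (subst ennreal_mult[symmetric]) (auto simp: survive_Suc)
  finally show ?case .
qed simp

lemma avoid_zero_0:
  "avoid {0} (Suc n) 0 = (\<integral>\<^sup>+y\<in>{0<..}. ennreal (\<beta> y) * ennreal (survive n y) \<partial>lborel)"
  unfolding avoid.simps
  by (subst nn_integral_jump_kernel_0) (auto intro!: nn_integral_cong simp: avoid_zero split: split_indicator)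

lemma mean_return_zero:
  "x > 0 \<Longrightarrow> mean_return {0} x = (\<Sum>n. ennreal (survive n x))"
  by (simp add: mean_return_def avoid_zero)

lemma mean_return_zero_0:
  "mean_return {0} 0 = 1 + (\<integral>\<^sup>+y\<in>{0<..}. ennreal (\<beta> y) * mean_return {0} y \<partial>lborel)"
  by (subst mean_return_step)
    (auto simp: nn_integral_jump_kernel_0 intro!: nn_integral_cong split: split_indicator)

lemma suminf_power_ennreal:
  assumes "0 < \<eta>" "\<eta> \<le> (1::real)"
  shows "(\<Sum>n. ennreal ((1 - \<eta>) ^ n)) = ennreal (1 / \<eta>)"
proof -
  have "(\<lambda>n. (1 - \<eta>) ^ n) sums (1 / (1 - (1 - \<eta>)))"
    using assms by (intro geometric_sums) auto
  then show ?thesis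
    using assms by (intro suminf_ennreal_eq) auto
qed

text \<open>Comparison with a geometric time of success probability \<eta>, whose mean is
  \<open>1 / \<eta>\<close>.\<close>

lemma mean_return_zero_ge:
  assumes "x > 0" "0 < \<eta>" "\<eta> \<le> 1" "\<And>y. y \<ge> x \<Longrightarrow> \<gamma> y \<le> \<eta>"
  shows "ennreal (1 / \<eta>) \<le> mean_return {0} x"
  unfolding mean_return_zero[OF assms(1)] suminf_power_ennreal[OF assms(2,3), symmetric]
  using assms by (intro suminf_le ennreal_leI survive_ge_power) auto

lemma mean_return_zero_le:
  assumes "x > 0" "0 < \<eta>" "\<And>y. y \<ge> x \<Longrightarrow> \<gamma> y \<ge> \<eta>"
  shows "mean_return {0} x \<le> ennreal (1 / \<eta>)"
proof -
  have "\<eta> \<le> 1" using assms(3)[of x] \<gamma>_less_1[of x] assms(1) by auto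
  then show ?thesis
    unfolding mean_return_zero[OF assms(1)] suminf_power_ennreal[OF assms(2) \<open>\<eta> \<le> 1\<close>, symmetric]
    using assms by (intro suminf_le ennreal_leI survive_le_power) auto
qed

text \<open>An uninterrupted climb is one way to avoid \<open>A\<close> when the orbit misses
  \<open>A\<close> after time 0. This gives lower bounds for return times to arbitrary petite
  sets.\<close>

lemma survive_le_avoid:
  assumes [measurable]: "A \<in> sets half_line" and "x > 0" "\<And>j. j \<ge> 1 \<Longrightarrow> x + real j \<notin> A"
  shows "ennreal (survive n x) \<le> avoid A n x"
  using assms(2,3)
proof (induction n arbitrary: x)
  case (Suc n)
  have "ennreal (survive n (x + 1)) \<le> avoid A n (x + 1)"
    using Suc.prems(1) Suc.prems(2)[of "Suc j" for j] by (intro Suc.IH) (auto simp: algebra_simps)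
  then have "ennreal (1 - \<gamma> x) * ennreal (survive n (x + 1)) \<le> ennreal (1 - \<gamma> x) * avoid A n (x + 1)"
    by (rule mult_left_mono) simp
  moreover have "ennreal (survive (Suc n) x) = ennreal (1 - \<gamma> x) * ennreal (survive n (x + 1))"
    using Suc.prems \<gamma>_less_1[of x] survive_nonneg[of "x + 1" n]
    by (subst ennreal_mult[symmetric]) (auto simp: survive_Suc)
  moreover have "indicator (- A) (x + 1) = (1::ennreal)"
    using Suc.prems(2)[of 1] by simp
  ultimately show ?case
    using Suc.prems(1) by (simp add: avoid_Suc_pos add_increasing del: avoid.simps)
qed simp

subsection \<open>Irreducibility and petite sets\<close>

lemma emeasure_kernel_pow_Suc_pos:
  assumes x: "x > 0" and A [measurable]: "A \<in> sets half_line"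
  shows "emeasure (kernel_pow half_line (jump_kernel \<gamma> \<beta>) (Suc n) x) A
    = ennreal (\<gamma> x) * emeasure (kernel_pow half_line (jump_kernel \<gamma> \<beta>) n 0) A
    + ennreal (1 - \<gamma> x) * emeasure (kernel_pow half_line (jump_kernel \<gamma> \<beta>) n (x + 1)) A"
  using x by (subst emeasure_kernel_pow_Suc) (auto intro!: nn_integral_jump_kernel_pos)

text \<open>A mixture of the laws of \<open>X 1, X 2, ...\<close> from 0. All geometric weights are
  positive, so its null sets are those that have probability 0 at every positive time, and its total
  mass is finite.\<close>

definition reach :: "real measure" where
  "reach = measure_pmf (geometric_pmf (1 / 2)) \<bind> (\<lambda>n. kernel_pow half_line (jump_kernel \<gamma> \<beta>) (Suc n) 0)"

lemma reach_measurable: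
  "(\<lambda>n. kernel_pow half_line (jump_kernel \<gamma> \<beta>) (Suc n) 0) \<in>
    measure_pmf (geometric_pmf (1 / 2)) \<rightarrow>\<^sub>M subprob_algebra half_line"
  using measurable_space[OF kernel_pow_measurable_subprob, of 0 "Suc n" for n]
  by (auto simp: measurable_pmf_measure1 simp del: kernel_pow.simps)

lemma sets_reach: "sets reach = sets half_line"
  unfolding reach_def by (rule sets_bind) (auto simp del: kernel_pow.simps)

lemma emeasure_reach_eq_0:
  assumes A: "A \<in> sets half_line"
  shows "emeasure reach A = 0 \<longleftrightarrow> (\<forall>n. emeasure (kernel_pow half_line (jump_kernel \<gamma> \<beta>) (Suc n) 0) A = 0)"
proof -
  have "emeasure reach A = (\<integral>\<^sup>+n. emeasure (kernel_pow half_line (jump_kernel \<gamma> \<beta>) (Suc n) 0) A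
      \<partial>measure_pmf (geometric_pmf (1 / 2)))"
    unfolding reach_def using A reach_measurable by (intro emeasure_bind) auto
  also have "\<dots> = 0 \<longleftrightarrow> (\<forall>n. emeasure (kernel_pow half_line (jump_kernel \<gamma> \<beta>) (Suc n) 0) A = 0)"
    by (subst nn_integral_0_iff_AE) (auto simp: AE_measure_pmf_iff set_pmf_geometric simp del: kernel_pow.simps)
  finally show ?thesis .
qed

text \<open>A state \<open>x > 0\<close> jumps to 0 with probability \<open>\<gamma> x > 0\<close>,
  and from 0 every set charged by \<open>reach\<close> is reached.\<close>

lemma irreducibility_reach: "irreducibility_measure half_line (jump_kernel \<gamma> \<beta>) reach"
  unfolding irreducibility_measure_def
proof (intro conjI ballI impI)
  have "subprob_space reach"
    unfolding reach_def
    by (rule subprob_space_bind[OF prob_space_imp_subprob_space reach_measurable]) unfold_locales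
  then interpret subprob_space reach .
  show "sigma_finite_measure reach" ..
  fix A x assume A [measurable]: "A \<in> sets half_line" and pos: "emeasure reach A > 0"
    and "x \<in> space half_line"
  let ?P = "kernel_pow half_line (jump_kernel \<gamma> \<beta>)"
  obtain n where n: "emeasure (?P (Suc n) 0) A > 0"
    using pos emeasure_reach_eq_0[OF A] by (auto simp: zero_less_iff_neq_zero)
  have "\<exists>m. emeasure (?P (Suc m) x) A > 0"
  proof (cases "x = 0")
    case True
    then show ?thesis using n by blast
  next
    case False
    then have x: "x > 0" using \<open>x \<in> space half_line\<close> by simp
    have "0 < ennreal (\<gamma> x) * emeasure (?P (Suc n) 0) A"
      using n x \<gamma>_pos[of x] by (simp add: ennreal_zero_less_mult_iff)
    also have "\<dots> \<le> emeasure (?P (Suc (Suc n)) x) A"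
      using x A by (subst emeasure_kernel_pow_Suc_pos) (auto simp del: kernel_pow.simps)
    finally show ?thesis by blast
  qed
  then obtain m where m: "emeasure (?P (Suc m) x) A > 0" by blast
  also have "emeasure (?P (Suc m) x) A \<le> (\<Sum>n. emeasure (?P (Suc n) x) A)"
    using sum_le_suminf[of "\<lambda>n. emeasure (?P (Suc n) x) A" "{m}"] by simp
  finally show "(\<Sum>n. emeasure (?P (Suc n) x) A) > 0" .
qed (rule sets_reach)

text \<open>\<open>reach\<close> is maximal, because an irreducibility measure that charges
  \<open>A\<close> forces \<open>A\<close> to be reachable from 0. Positivity of a set is thus
  reduced to reachability from one state.\<close>

lemma positive_sets_iff:
  "A \<in> positive_sets half_line (jump_kernel \<gamma> \<beta>) \<longleftrightarrow> A \<in> sets half_line \<and>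
    (\<exists>n. emeasure (kernel_pow half_line (jump_kernel \<gamma> \<beta>) (Suc n) 0) A > 0)"
proof -
  let ?P = "kernel_pow half_line (jump_kernel \<gamma> \<beta>)"
  have imp: "\<exists>n. emeasure (?P (Suc n) 0) A > 0"
    if "irreducibility_measure half_line (jump_kernel \<gamma> \<beta>) \<phi>" "A \<in> sets half_line" "emeasure \<phi> A > 0" for \<phi> A
  proof (rule ccontr)
    assume "\<not> ?thesis"
    then have "(\<Sum>n. emeasure (?P (Suc n) 0) A) = 0"
      by (simp add: zero_less_iff_neq_zero del: kernel_pow.simps)
    moreover have "(\<Sum>n. emeasure (?P (Suc n) 0) A) > 0"
      using that unfolding irreducibility_measure_def space_half_line by (metis atLeast_iff order_refl)
    ultimately show False by simp
  qed
  have "maximal_irreducibility_measure half_line (jump_kernel \<gamma> \<beta>) reach"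
    unfolding maximal_irreducibility_measure_def
  proof (intro conjI allI impI irreducibility_reach)
    fix \<phi> assume \<phi>: "irreducibility_measure half_line (jump_kernel \<gamma> \<beta>) \<phi>"
    then have [simp]: "sets \<phi> = sets half_line" by (simp add: irreducibility_measure_def)
    show "absolutely_continuous reach \<phi>"
      unfolding absolutely_continuous_def
    proof
      fix A assume "A \<in> null_sets reach"
      then have A: "A \<in> sets half_line" "emeasure reach A = 0" by (auto simp: sets_reach)
      have "\<not> emeasure \<phi> A > 0"
      proof
        assume "emeasure \<phi> A > 0"
        from imp[OF \<phi> A(1) this] obtain n where "emeasure (?P (Suc n) 0) A > 0" by blast
        moreover have "emeasure (?P (Suc n) 0) A = 0" using emeasure_reach_eq_0[OF A(1)] A(2) by blast
        ultimately show False by simp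
      qed
      then have "emeasure \<phi> A = 0" by (simp only: not_gr_zero)
      then show "A \<in> null_sets \<phi>" using A by auto
    qed
  qed
  moreover have "emeasure reach A > 0" if "A \<in> sets half_line" "\<exists>n. emeasure (?P (Suc n) 0) A > 0"
    using that emeasure_reach_eq_0[of A] by (auto simp: zero_less_iff_neq_zero simp del: kernel_pow.simps)
  ultimately show ?thesis
    using imp by (auto simp: positive_sets_def maximal_irreducibility_measure_def simp del: kernel_pow.simps)
qed

text \<open>The chain can leave 0 and jump straight back: the two-step return probability is the
  integral of \<open>\<beta> * \<gamma>\<close>, which is positive.\<close>

lemma zero_positive: "{0} \<in> positive_sets half_line (jump_kernel \<gamma> \<beta>)"
proof -
  let ?P = "kernel_pow half_line (jump_kernel \<gamma> \<beta>)"
  have P1: "emeasure (?P (Suc 0) y) {0} = ennreal (\<gamma> y)" if "y > 0" for y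
    using that by (subst emeasure_kernel_pow_Suc_pos) auto
  have "0 < (\<integral>\<^sup>+y\<in>{0<..}. ennreal (\<beta> y) * emeasure (?P (Suc 0) y) {0} \<partial>lborel)"
    using P1 \<gamma>_pos by (intro nn_integral_\<beta>_pos emeasure_kernel_pow_measurable zero_sets) (auto simp del: kernel_pow.simps)
  then have "emeasure (?P (Suc (Suc 0)) 0) {0} > 0"
    unfolding emeasure_kernel_pow_Suc[of 0 "{0}" "Suc 0", simplified space_half_line atLeast_iff, OF order_refl zero_sets]
    by (subst nn_integral_jump_kernel_0) (auto simp del: kernel_pow.simps)
  then show ?thesis unfolding positive_sets_iff by (blast intro: zero_sets)
qed

text \<open>Sampling at time 0 only, with the point mass at 0 as minorising measure.\<close>

lemma petite_zero: "petite half_line (jump_kernel \<gamma> \<beta>) {0}"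
  unfolding petite_def
proof (intro conjI exI[of _ "return_pmf 0"] exI[of _ "return half_line 0"] ballI)
  fix x :: real and B assume "x \<in> {0}" "B \<in> sets half_line"
  then show "emeasure (return half_line 0) B \<le>
    (\<Sum>n. ennreal (pmf (return_pmf 0) n) * emeasure (kernel_pow half_line (jump_kernel \<gamma> \<beta>) n x) B)"
    using sum_le_suminf[of "\<lambda>n. ennreal (pmf (return_pmf 0) n) * emeasure (kernel_pow half_line (jump_kernel \<gamma> \<beta>) n x) B" "{0}"]
    by simp
qed (use sets.top[of half_line] in auto)

text \<open>The climb of length \<open>n\<close> ends at \<open>x + n\<close>; if this point lies
  outside \<open>B\<close>, the probability \<open>survive n x\<close> of the climb is lost.\<close>

lemma emeasure_kernel_pow_le:
  assumes "x > 0" and B: "B \<in> sets half_line"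
  shows "emeasure (kernel_pow half_line (jump_kernel \<gamma> \<beta>) n x) B
    \<le> ennreal (1 - survive n x * indicator (- B) (x + real n))"
  using assms(1)
proof (induction n arbitrary: x)
  case 0
  then show ?case using B by (auto split: split_indicator)
next
  case (Suc n)
  let ?P = "kernel_pow half_line (jump_kernel \<gamma> \<beta>)"
  let ?i = "indicator (- B) (x + real (Suc n)) :: real"
  have i: "indicator (- B) (x + 1 + real n) = ?i" by (simp add: algebra_simps)
  have \<gamma>: "0 < \<gamma> x" "\<gamma> x < 1" using \<gamma>_bounds[of x] Suc.prems by auto
  have nonneg: "0 \<le> 1 - survive n (x + 1) * ?i"
    using survive_le_1[of "x + 1" n] Suc.prems by (auto split: split_indicator)
  have "emeasure (?P (Suc n) x) B = ennreal (\<gamma> x) * emeasure (?P n 0) B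
      + ennreal (1 - \<gamma> x) * emeasure (?P n (x + 1)) B"
    by (rule emeasure_kernel_pow_Suc_pos[OF Suc.prems B])
  also have "\<dots> \<le> ennreal (\<gamma> x) * 1 + ennreal (1 - \<gamma> x) * ennreal (1 - survive n (x + 1) * ?i)"
    using Suc.IH[of "x + 1"] Suc.prems unfolding i
    by (intro add_mono mult_left_mono emeasure_kernel_pow_le_1) auto
  also have "\<dots> = ennreal (\<gamma> x + (1 - \<gamma> x) * (1 - survive n (x + 1) * ?i))"
    using \<gamma> nonneg by (simp add: ennreal_mult ennreal_plus)
  also have "\<gamma> x + (1 - \<gamma> x) * (1 - survive n (x + 1) * ?i) = 1 - survive (Suc n) x * ?i"
    by (simp add: survive_Suc algebra_simps)
  finally show ?case .
qed

text \<open>The minorising measure charges a set on which \<open>\<gamma>\<close> is bounded below, and every visit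
  to that set leads to \<open>0\<close> in one step with a fixed probability.\<close>

lemma petite_survive_le:
  assumes "petite half_line (jump_kernel \<gamma> \<beta>) C"
  obtains N \<epsilon> where "\<epsilon> > 0" "\<And>x. x \<in> C \<Longrightarrow> x > 0 \<Longrightarrow> survive N x \<le> 1 - \<epsilon>"
proof -
  let ?P = "kernel_pow half_line (jump_kernel \<gamma> \<beta>)"
  obtain a :: "nat pmf" and \<nu> where \<nu>: "sets \<nu> = sets half_line" "emeasure \<nu> (space \<nu>) > 0"
    and minor: "\<And>x B. x \<in> C \<Longrightarrow> B \<in> sets half_line \<Longrightarrow>
      emeasure \<nu> B \<le> (\<Sum>n. ennreal (pmf a n) * emeasure (?P n x) B)"
    using assms unfolding petite_def by blast
  \<comment> \<open>These sets exhaust the half-line because \<gamma> is positive, so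
    \<open>\<nu>\<close> charges one of them.\<close>
  define B where "B k = {y \<in> space half_line. y = 0 \<or> \<gamma> y \<ge> 1 / (real k + 1)}" for k :: nat
  have B [measurable]: "B k \<in> sets half_line" for k
  proof -
    have "B k = {0} \<union> {y \<in> space half_line. \<gamma> y \<ge> 1 / (real k + 1)}" by (auto simp: B_def)
    also have "\<dots> \<in> sets half_line" by (rule sets.Un[OF zero_sets]) measurable
    finally show ?thesis .
  qed
  have "\<exists>k. emeasure \<nu> (B k) > 0"
  proof (rule ccontr)
    assume "\<not> ?thesis"
    then have "B k \<in> null_sets \<nu>" for k using B \<nu>(1) by (auto simp: zero_less_iff_neq_zero)
    then have "(\<Union>k. B k) \<in> null_sets \<nu>" by (intro null_sets_UN) auto
    moreover have "(\<Union>k. B k) = space \<nu>"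
    proof -
      have "\<exists>k. y \<in> B k" if y: "y \<ge> 0" for y
      proof -
        obtain k where "1 / (real k + 1) < \<gamma> y"
          using reals_Archimedean[OF \<gamma>_pos[OF y]] by (auto simp: inverse_eq_divide add.commute)
        then show ?thesis using y by (intro exI[of _ k]) (auto simp: B_def)
      qed
      then show ?thesis using sets_eq_imp_space_eq[OF \<nu>(1)] by (auto simp: B_def)
    qed
    ultimately show False using \<nu>(2) by auto
  qed
  then obtain k where k: "emeasure \<nu> (B k) > 0" by blast
  define \<delta> where "\<delta> = 1 / (real k + 1)"
  have \<delta>: "\<delta> > 0" "\<delta> \<le> 1" by (auto simp: \<delta>_def)
  \<comment> \<open>If the climb is in \<open>B k\<close> at time \<open>n\<close>, the next step
    jumps to 0 with probability at least \<delta>. If it is not, being in \<open>B k\<close> at time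
    \<open>n\<close> already requires an earlier jump.\<close>
  have hit: "ennreal \<delta> * emeasure (?P n x) (B k) \<le> ennreal (1 - survive (Suc n) x)" if "x > 0" for n x
  proof -
    have "\<delta> * (1 - survive n x * indicator (- B k) (x + real n)) \<le> 1 - survive (Suc n) x"
    proof (cases "x + real n \<in> B k")
      case True
      then have "\<delta> \<le> \<gamma> (x + real n)" using that by (auto simp: B_def \<delta>_def)
      moreover have "0 \<le> survive n x" "survive n x \<le> 1"
        using survive_nonneg survive_le_1 that by auto
      ultimately have "survive n x * (1 - \<gamma> (x + real n)) \<le> 1 * (1 - \<delta>)"
        using \<gamma>_less_1[of "x + real n"] that by (intro mult_mono) auto
      then show ?thesis using True by (simp add: survive_Suc_right)
    next
      case False
      have "\<delta> * (1 - survive n x) \<le> 1 * (1 - survive n x)"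
        using \<delta> survive_le_1[of x n] that by (intro mult_right_mono) auto
      also have "\<dots> \<le> 1 - survive (Suc n) x"
        using survive_antimono[of x n "Suc n"] that by simp
      finally show ?thesis using False by simp
    qed
    moreover have "ennreal \<delta> * emeasure (?P n x) (B k)
        \<le> ennreal \<delta> * ennreal (1 - survive n x * indicator (- B k) (x + real n))"
      by (intro mult_left_mono emeasure_kernel_pow_le that B) simp
    moreover have "0 \<le> 1 - survive n x * indicator (- B k) (x + real n)"
      using survive_le_1[of x n] that by (auto split: split_indicator)
    ultimately show ?thesis
      using \<delta> by (simp add: ennreal_mult[symmetric]) (meson ennreal_leI order_trans)
  qed
  \<comment> \<open>For empty \<open>C\<close> the mass of \<open>B k\<close> may be infinite; the
    minimum with 1 keeps \<open>e\<close> finite.\<close>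
  define e where "e = min 1 (ennreal \<delta> * emeasure \<nu> (B k))"
  have "e > 0" using k \<delta> by (auto simp: e_def ennreal_zero_less_mult_iff)
  moreover have "e \<noteq> top" by (auto simp: e_def min_def top_unique)
  ultimately have e: "e > 0" "e \<noteq> top" .
  obtain \<epsilon> where \<epsilon>: "e = ennreal \<epsilon>" "\<epsilon> > 0"
    using e by (cases e) auto
  have pmf_sums: "pmf a sums 1"
  proof -
    have "(\<Sum>n. ennreal (pmf a n)) = emeasure (measure_pmf a) UNIV"
      by (simp add: nn_integral_count_space_nat[symmetric] nn_integral_pmf)
    then have "(\<lambda>n. ennreal (pmf a n)) sums ennreal 1"
      using summable_sums[of "\<lambda>n. ennreal (pmf a n)"] by (simp add: measure_pmf.emeasure_eq_1_AE)
    then show ?thesis by (subst (asm) sums_ennreal) auto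
  qed
  then have "(\<lambda>N. \<Sum>n<N. pmf a n) \<longlonglongrightarrow> 1"
    by (simp add: sums_def)
  \<comment> \<open>From \<open>N\<close> on, the sampling distribution has mass less than
    \<open>\<epsilon> / 2\<close>, so truncating there costs at most half of the gain.\<close>
  then have "\<forall>\<^sub>F N in sequentially. (\<Sum>n<N. pmf a n) > 1 - \<epsilon> / 2"
    using \<epsilon>(2) by (intro order_tendstoD(1)) auto
  then obtain N where N: "(\<Sum>n<N. pmf a n) > 1 - \<epsilon> / 2"
    by (meson eventually_sequentially le_refl)
  have "survive N x \<le> 1 - \<epsilon> / 2" if x: "x \<in> C" "x > 0" for x
  proof -
    let ?s = "survive N x" and ?p = "\<Sum>n<N. pmf a n"
    have s: "0 \<le> ?s" "?s \<le> 1" using survive_le_1 survive_nonneg x(2) by auto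
    have "?p \<le> 1" using sum_le_suminf[of "pmf a" "{..<N}"] pmf_sums by (auto simp: sums_iff)
    then have ps: "0 \<le> 1 - ?s * ?p" using s by (simp add: mult_le_one sum_nonneg)
    have "e \<le> ennreal \<delta> * (\<Sum>n. ennreal (pmf a n) * emeasure (?P n x) (B k))"
      unfolding e_def by (intro min.coboundedI2 mult_left_mono minor x B) simp
    also have "\<dots> = (\<Sum>n. ennreal (pmf a n) * (ennreal \<delta> * emeasure (?P n x) (B k)))"
      by (simp add: mult.left_commute)
    also have "\<dots> \<le> (\<Sum>n. ennreal (pmf a n) * ennreal (1 - survive (Suc n) x))"
      by (intro suminf_le mult_left_mono hit x) auto
    \<comment> \<open>For \<open>n < N\<close> monotonicity replaces
      \<open>survive (Suc n) x\<close> by the smaller \<open>survive N x\<close>; every other term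
      is bounded by \<open>pmf a n\<close>.\<close>
    also have "\<dots> \<le> (\<Sum>n. ennreal (pmf a n - (if n \<in> {..<N} then ?s * pmf a n else 0)))"
    proof (intro suminf_le)
      fix n
      have "survive N x \<le> survive (Suc n) x" if "n < N"
        using that x(2) by (intro survive_antimono) auto
      moreover have "0 \<le> survive (Suc n) x" "survive (Suc n) x \<le> 1"
        using survive_le_1 survive_nonneg x(2) by auto
      ultimately have "pmf a n * (1 - survive (Suc n) x) \<le> pmf a n * (1 - (if n \<in> {..<N} then ?s else 0))"
        by (intro mult_left_mono) auto
      then show "ennreal (pmf a n) * ennreal (1 - survive (Suc n) x)
          \<le> ennreal (pmf a n - (if n \<in> {..<N} then ?s * pmf a n else 0))"
        using \<open>survive (Suc n) x \<le> 1\<close>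
        by (subst ennreal_mult[symmetric]) (auto intro!: ennreal_leI simp: algebra_simps split: if_splits)
    qed auto
    also have "\<dots> = ennreal (1 - ?s * ?p)"
    proof (rule suminf_ennreal_eq)
      show "(\<lambda>n. pmf a n - (if n \<in> {..<N} then ?s * pmf a n else 0)) sums (1 - ?s * ?p)"
        unfolding sum_distrib_left by (intro sums_diff pmf_sums sums_If_finite_set) simp
      show "0 \<le> pmf a n - (if n \<in> {..<N} then ?s * pmf a n else 0)" for n
        using s by (simp add: mult_left_le_one_le)
    qed
    finally have "\<epsilon> \<le> 1 - ?s * ?p"
      unfolding \<epsilon>(1) using ps by (simp add: ennreal_le_iff)
    moreover have "?s * (1 - \<epsilon> / 2) \<le> ?s * ?p"
      using N s by (intro mult_left_mono) auto
    moreover have "?s * \<epsilon> \<le> 1 * \<epsilon>"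
      using s \<epsilon>(2) by (intro mult_right_mono) auto
    ultimately show ?thesis by (simp add: algebra_simps)
  qed
  then show ?thesis using \<epsilon>(2) by (intro that[of "\<epsilon> / 2" N]) auto
qed

subsection \<open>Recurrence, transience and mean return times\<close>

lemma INF_avoid_eq_0:
  assumes lim: "\<And>x. x > 0 \<Longrightarrow> (\<lambda>n. survive n x) \<longlonglongrightarrow> 0"
    and A: "A \<in> positive_sets half_line (jump_kernel \<gamma> \<beta>)" and y: "y \<in> space half_line"
  shows "(INF n. avoid A n y) = 0"
proof -
  define f where "f x = (INF n. avoid A n x)" for x
  have A_sets [measurable]: "A \<in> sets half_line" using A by (simp add: positive_sets_iff)
  have [measurable]: "f \<in> borel_measurable half_line" unfolding f_def by simp
  have step: "f x \<le> (\<integral>\<^sup>+y. indicator (- A) y * f y \<partial>jump_kernel \<gamma> \<beta> x)" if "x \<in> space half_line" for x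
    unfolding f_def using INF_avoid_step[OF A_sets that] by simp
  \<comment> \<open>Either the first \<open>n\<close> steps are all climbs, which has probability
    \<open>survive n x\<close>, or the chain has restarted from 0, with chance at most
    \<open>f 0\<close> of avoiding \<open>A\<close> for ever.\<close>
  have approx: "f x \<le> f 0 + ennreal (survive n x)" if "x > 0" for n x
    using that
  proof (induction n arbitrary: x)
    case 0
    have "f x \<le> avoid A 0 x" unfolding f_def by (rule INF_lower) simp
    then show ?case by (simp add: add_increasing)
  next
    case (Suc n)
    have \<gamma>: "0 < \<gamma> x" "\<gamma> x < 1" using \<gamma>_bounds[of x] Suc.prems by auto
    have "f x \<le> ennreal (\<gamma> x) * (indicator (- A) 0 * f 0)
        + ennreal (1 - \<gamma> x) * (indicator (- A) (x + 1) * f (x + 1))"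
      using step[of x] nn_integral_jump_kernel_pos[OF Suc.prems, of "\<lambda>y. indicator (- A) y * f y"] Suc.prems
      by simp
    also have "\<dots> \<le> ennreal (\<gamma> x) * f 0 + ennreal (1 - \<gamma> x) * (f 0 + ennreal (survive n (x + 1)))"
      using Suc.IH[of "x + 1"] Suc.prems
      by (intro add_mono mult_left_mono) (auto split: split_indicator)
    also have "\<dots> = (ennreal (\<gamma> x) + ennreal (1 - \<gamma> x)) * f 0 + ennreal (1 - \<gamma> x) * ennreal (survive n (x + 1))"
      by (simp add: distrib_left distrib_right add.assoc)
    also have "ennreal (\<gamma> x) + ennreal (1 - \<gamma> x) = 1"
      using \<gamma> by (subst ennreal_plus[symmetric]) auto
    also have "ennreal (1 - \<gamma> x) * ennreal (survive n (x + 1)) = ennreal (survive (Suc n) x)"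
      using \<gamma> survive_nonneg[of "x + 1" n] Suc.prems by (subst ennreal_mult[symmetric]) (auto simp: survive_Suc)
    finally show ?case by simp
  qed
  have le: "f x \<le> f 0" if "x \<in> space half_line" for x
  proof (cases "x = 0")
    case False
    then have x: "x > 0" using that by simp
    have "(\<lambda>n. f 0 + ennreal (survive n x)) \<longlonglongrightarrow> f 0 + ennreal 0"
      by (intro tendsto_add tendsto_const tendsto_ennrealI lim x)
    then show ?thesis
      using approx[OF x] by (intro LIMSEQ_le_const[of _ "f 0" "f x"]) auto
  qed simp
  obtain n where n: "emeasure (kernel_pow half_line (jump_kernel \<gamma> \<beta>) (Suc n) 0) A > 0"
    using A by (auto simp: positive_sets_iff)
  \<comment> \<open>\<open>A\<close> is hit from 0 at time \<open>n + 1\<close> with positive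
    probability, so it cannot be avoided up to then almost surely.\<close>
  have "avoid A (Suc n) 0 < 1"
  proof (rule ccontr)
    assume "\<not> ?thesis"
    then have "1 + emeasure (kernel_pow half_line (jump_kernel \<gamma> \<beta>) (Suc n) 0) A
        \<le> avoid A (Suc n) 0 + emeasure (kernel_pow half_line (jump_kernel \<gamma> \<beta>) (Suc n) 0) A"
      by (intro add_right_mono) (simp add: not_less)
    also have "\<dots> \<le> 1 + 0" using avoid_plus_hit[OF A_sets, of 0 n] by simp
    finally show False using n by (subst (asm) ennreal_add_left_cancel_le) auto
  qed
  then obtain c where c: "avoid A (Suc n) 0 = ennreal c" "0 \<le> c" "c < 1"
    by (cases "avoid A (Suc n) 0") (auto simp del: avoid.simps)
  have "f 0 \<le> avoid A 0 0" unfolding f_def by (rule INF_lower) simp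
  then obtain r where r: "f 0 = ennreal r" "0 \<le> r"
    by (cases "f 0") (auto simp: top_unique)
  \<comment> \<open>The constant in \<open>avoid_le_multiple\<close> is \<open>f 0\<close>, the
    upper bound of \<open>f\<close>. As the other factor is less than 1, \<open>f 0\<close> must
    vanish.\<close>
  have "f 0 \<le> f 0 * avoid A (Suc n) 0"
    by (rule avoid_le_multiple[OF A_sets le step]) auto
  then have "r \<le> r * c"
    unfolding r c using r c by (simp add: ennreal_mult[symmetric])
  then have "r * (1 - c) \<le> 0" by (simp add: algebra_simps)
  then have "r = 0" using r c by (simp add: mult_le_0_iff)
  then have "f 0 = 0" using r by simp
  then show ?thesis using le[OF y] by (simp add: f_def)
qed

lemma survive_tendsto_0_if_mean_return:
  assumes "x > 0" "mean_return {0} x < \<infinity>"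
  shows "(\<lambda>n. survive n x) \<longlonglongrightarrow> 0"
proof -
  have "summable (\<lambda>n. survive n x)"
    using assms survive_nonneg[of x]
    by (intro summable_suminf_not_top) (auto simp: mean_return_zero)
  then show ?thesis by (rule summable_LIMSEQ_zero)
qed

section \<open>Comparison with products over unit intervals\<close>

lemma SUP_compl_bounds:
  fixes k :: nat
  assumes "real k \<le> x" "x < real k + 1"
  shows "1 - \<gamma> x \<le> (SUP y\<in>{real k..<real k + 1}. 1 - \<gamma> y)" (is "_ \<le> ?S")
    and "(INF y\<in>{real k..<real k + 1}. 1 - \<gamma> y) \<le> 1 - \<gamma> x" (is "?I \<le> _")
    and "0 < (SUP y\<in>{real k..<real k + 1}. 1 - \<gamma> y)"
    and "0 \<le> (INF y\<in>{real k..<real k + 1}. 1 - \<gamma> y)"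
    and "(INF y\<in>{real k..<real k + 1}. 1 - \<gamma> y) \<le> 1"
proof -
  have \<gamma>: "0 < \<gamma> y \<and> \<gamma> y < 1" if "real k \<le> y" for y
    using \<gamma>_bounds[of y] that by auto
  have above: "bdd_above ((\<lambda>y. 1 - \<gamma> y) ` {real k..<real k + 1})"
    using \<gamma> by (intro bdd_aboveI[of _ 1]) (auto simp: less_imp_le)
  have below: "bdd_below ((\<lambda>y. 1 - \<gamma> y) ` {real k..<real k + 1})"
    using \<gamma> by (intro bdd_belowI[of _ 0]) (auto simp: less_imp_le)
  show 1: "1 - \<gamma> x \<le> ?S" using assms by (intro cSUP_upper above) auto
  show 2: "?I \<le> 1 - \<gamma> x" using assms by (intro cINF_lower below) auto
  show "0 < ?S" using 1 \<gamma>[of x] assms by auto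
  show "0 \<le> ?I" using \<gamma> by (intro cINF_greatest) (auto simp: less_imp_le)
  show "?I \<le> 1" using 2 \<gamma>[of x] assms by auto
qed

text \<open>The orbit \<open>x + K, x + K + 1, \<dots>\<close> visits the unit intervals starting at
  \<open>\<lfloor>x\<rfloor> + K, \<lfloor>x\<rfloor> + K + 1, \<dots>\<close> once each.\<close>

lemma survive_le_prod_SUP:
  assumes "x \<ge> 0"
  shows "survive (Suc n) (x + real K) \<le>
    (\<Prod>k=nat \<lfloor>x\<rfloor> + K..nat \<lfloor>x\<rfloor> + K + n. (SUP y\<in>{real k..<real k + 1}. 1 - \<gamma> y))" (is "_ \<le> prod ?s _")
proof -
  let ?m = "nat \<lfloor>x\<rfloor> + K"
  have "survive (Suc n) (x + real K) = (\<Prod>j\<le>n. 1 - \<gamma> (x + real K + real j))"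
    by (simp add: survive_def lessThan_Suc_atMost)
  also have "\<dots> \<le> (\<Prod>j\<le>n. ?s (?m + j))"
  proof (intro prod_mono conjI)
    fix j
    show "0 \<le> 1 - \<gamma> (x + real K + real j)"
      using \<gamma>_less_1[of "x + real K + real j"] assms by simp
    have "real (?m + j) \<le> x + real K + real j" "x + real K + real j < real (?m + j) + 1"
      using assms by linarith+
    then show "1 - \<gamma> (x + real K + real j) \<le> ?s (?m + j)" by (rule SUP_compl_bounds(1))
  qed
  also have "\<dots> = prod ?s {?m..?m + n}"
    using prod.shift_bounds_cl_nat_ivl[of ?s 0 ?m n] by (simp add: atMost_atLeast0 add.commute)
  finally show ?thesis .
qed

lemma prod_INF_le_survive:
  assumes "x \<ge> 0"
  shows "(\<Prod>k=nat \<lfloor>x\<rfloor> + K..nat \<lfloor>x\<rfloor> + K + n. (INF y\<in>{real k..<real k + 1}. 1 - \<gamma> y))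
    \<le> survive (Suc n) (x + real K)" (is "prod ?s _ \<le> _")
proof -
  let ?m = "nat \<lfloor>x\<rfloor> + K"
  have "prod ?s {?m..?m + n} = (\<Prod>j\<le>n. ?s (?m + j))"
    using prod.shift_bounds_cl_nat_ivl[of ?s 0 ?m n] by (simp add: atMost_atLeast0 add.commute)
  also have "\<dots> \<le> (\<Prod>j\<le>n. 1 - \<gamma> (x + real K + real j))"
  proof (intro prod_mono conjI)
    fix j
    have "real (?m + j) \<le> x + real K + real j" "x + real K + real j < real (?m + j) + 1"
      using assms by linarith+
    then show "0 \<le> ?s (?m + j)" "?s (?m + j) \<le> 1 - \<gamma> (x + real K + real j)"
      by (rule SUP_compl_bounds)+
  qed
  also have "\<dots> = survive (Suc n) (x + real K)"
    by (simp add: survive_def lessThan_Suc_atMost)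
  finally show ?thesis .
qed

text \<open>Discarding the first \<open>K\<close> steps of the orbit ensures that the remaining ones
  meet only unit intervals of index at least \<open>K\<close>. The intervals from \<open>K\<close>
  up to \<open>m\<close> contribute a positive constant \<open>c\<close>, which does not affect the
  limit 0.\<close>

lemma survive_tendsto_0:
  assumes lim: "(\<lambda>n. \<Prod>k=K..n. (SUP y\<in>{real k..<real k + 1}. 1 - \<gamma> y)) \<longlonglongrightarrow> 0"
    and x: "x > 0"
  shows "(\<lambda>n. survive n x) \<longlonglongrightarrow> 0"
proof -
  let ?s = "\<lambda>k::nat. (SUP y\<in>{real k..<real k + 1}. 1 - \<gamma> y)"
  define m where "m = nat \<lfloor>x\<rfloor> + K"
  define c where "c = prod ?s {K..<m}"
  have "c > 0"
    unfolding c_def using SUP_compl_bounds(3)[of k "real k" for k] by (intro prod_pos) auto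
  have bound: "survive (Suc n + K) x \<le> prod ?s {K..n + m} / c" for n
  proof -
    have "survive (Suc n + K) x = survive K x * survive (Suc n) (x + real K)"
      using survive_add[of K "Suc n" x] by (simp add: add.commute)
    also have "\<dots> \<le> survive (Suc n) (x + real K)"
      using survive_le_1[of x K] survive_nonneg[of "x + real K" "Suc n"] survive_nonneg[of x K] x
      by (intro mult_left_le_one_le) auto
    also have "\<dots> \<le> prod ?s {m..m + n}"
      unfolding m_def using x by (intro survive_le_prod_SUP) simp
    also have "\<dots> = prod ?s {K..n + m} / c"
    proof -
      have eq: "{K..n + m} = {K..<m} \<union> {m..m + n}" by (auto simp: m_def)
      have "prod ?s {K..n + m} = c * prod ?s {m..m + n}"
        unfolding c_def eq by (rule prod.union_disjoint) auto
      then show ?thesis using \<open>c > 0\<close> by simp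
    qed
    finally show ?thesis .
  qed
  have "(\<lambda>n. prod ?s {K..n + m} / c) \<longlonglongrightarrow> 0 / c"
    by (rule tendsto_divide[OF LIMSEQ_ignore_initial_segment[OF lim] tendsto_const]) (use \<open>c > 0\<close> in simp)
  then have upper: "(\<lambda>n. prod ?s {K..n + m} / c) \<longlonglongrightarrow> 0" by simp
  have "(\<lambda>n. survive (Suc n + K) x) \<longlonglongrightarrow> 0"
  proof (rule tendsto_sandwich[OF _ _ tendsto_const upper])
    show "\<forall>\<^sub>F n in sequentially. 0 \<le> survive (Suc n + K) x"
      by (rule always_eventually, rule allI, rule survive_nonneg) (use x in simp)
    show "\<forall>\<^sub>F n in sequentially. survive (Suc n + K) x \<le> prod ?s {K..n + m} / c"
      by (rule always_eventually, rule allI, rule bound)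
  qed
  then have "(\<lambda>n. survive (n + Suc K) x) \<longlonglongrightarrow> 0" by (simp only: add_Suc add_Suc_right)
  then show ?thesis by (rule LIMSEQ_offset)
qed

text \<open>All factors are at most 1, so the partial products decrease to \<open>L\<close> and stay
  above it. The factor \<open>survive K x\<close> accounts for the first \<open>K\<close> steps,
  which may lie in intervals of index below \<open>K\<close>.\<close>

lemma survive_bounded_below:
  assumes lim: "(\<lambda>n. \<Prod>k=K..n. (INF y\<in>{real k..<real k + 1}. 1 - \<gamma> y)) \<longlonglongrightarrow> L"
    and x: "x \<ge> 0"
  shows "survive K x * L \<le> survive n x"
proof -
  let ?s = "\<lambda>k::nat. (INF y\<in>{real k..<real k + 1}. 1 - \<gamma> y)"
  have s: "0 \<le> ?s k" "?s k \<le> 1" for k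
    using SUP_compl_bounds(4,5)[of k "real k"] by auto
  define m where "m = nat \<lfloor>x\<rfloor> + K"
  have "decseq (\<lambda>n. prod ?s {K..n})"
  proof (rule decseq_SucI)
    fix n
    show "prod ?s {K..Suc n} \<le> prod ?s {K..n}"
    proof (cases "K \<le> Suc n")
      case True
      then have eq: "{K..Suc n} = insert (Suc n) {K..n}" by auto
      have "prod ?s {K..Suc n} = ?s (Suc n) * prod ?s {K..n}"
        unfolding eq by (rule prod.insert) auto
      also have "\<dots> \<le> prod ?s {K..n}"
        by (intro mult_left_le_one_le prod_nonneg s)
      finally show ?thesis .
    qed simp
  qed
  then have "L \<le> prod ?s {K..m + n}" using lim by (intro decseq_ge)
  also have "\<dots> = prod ?s {K..<m} * prod ?s {m..m + n}"
  proof -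
    have eq: "{K..m + n} = {K..<m} \<union> {m..m + n}" by (auto simp: m_def)
    show ?thesis unfolding eq by (rule prod.union_disjoint) auto
  qed
  also have "\<dots> \<le> prod ?s {m..m + n}"
    using s by (intro mult_left_le_one_le prod_nonneg prod_le_1) auto
  also have "\<dots> \<le> survive (Suc n) (x + real K)"
    unfolding m_def by (rule prod_INF_le_survive[OF x])
  finally have "survive K x * L \<le> survive K x * survive (Suc n) (x + real K)"
    using survive_nonneg[OF x] by (intro mult_left_mono)
  also have "\<dots> = survive (K + Suc n) x" by (simp only: survive_add)
  also have "\<dots> \<le> survive n x" using x by (intro survive_antimono) auto
  finally show ?thesis .
qed

section \<open>Upper bounds for mean return times to 0\<close>

lemma \<gamma>_bounded_below_compact:
  obtains d where "d > 0" "\<And>y. 0 \<le> y \<Longrightarrow> y \<le> b \<Longrightarrow> d \<le> \<gamma> y"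
proof (cases "0 \<le> b")
  case True
  have "continuous_on {0..b} \<gamma>" using \<gamma>_cont by (rule continuous_on_subset) auto
  then obtain z where "z \<in> {0..b}" "\<forall>y\<in>{0..b}. \<gamma> z \<le> \<gamma> y"
    using continuous_attains_inf[of "{0..b}" \<gamma>] True by auto
  then show ?thesis using \<gamma>_pos[of z] by (intro that[of "\<gamma> z"]) auto
next
  case False
  then show ?thesis by (intro that[of 1]) auto
qed

text \<open>Each step costs one unit of time and continues upwards with probability at most 1. This
  transfers bounds that hold far out to points near 0.\<close>

lemma mean_return_zero_shift_le:
  assumes "x > 0"
  shows "mean_return {0} x \<le> of_nat K + mean_return {0} (x + real K)"
proof (induction K)
  case (Suc K)
  have pos: "x + real K > 0" using assms by simp
  have "mean_return {0} (x + real K) = 1 + ennreal (1 - \<gamma> (x + real K)) * mean_return {0} (x + real K + 1)"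
    using pos by (subst mean_return_step) (auto simp: nn_integral_jump_kernel_pos)
  also have "\<dots> \<le> 1 + 1 * mean_return {0} (x + real (Suc K))"
    using \<gamma>_pos[of "x + real K"] pos
    by (intro add_left_mono mult_mono) (auto simp: algebra_simps ennreal_le_1)
  finally have "mean_return {0} (x + real K) \<le> 1 + mean_return {0} (x + real (Suc K))" by simp
  then have "mean_return {0} x \<le> of_nat K + (1 + mean_return {0} (x + real (Suc K)))"
    by (rule order_trans[OF Suc add_left_mono])
  then show ?case by (simp only: of_nat_Suc add_ac)
qed simp

text \<open>The Lyapunov function is \<open>c / \<gamma> x\<close> with
  \<open>c = 1 / (1 - \<theta>)\<close>, chosen so that \<open>c - c * \<theta> = 1\<close> pays for
  the elapsed step.\<close>

lemma mean_return_zero_le_inverse: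
  assumes "0 \<le> x1" "\<theta> < 1" "0 \<le> \<theta>"
    and incr: "\<And>x. x > x1 \<Longrightarrow> 1 / \<gamma> (x + 1) - 1 / \<gamma> x \<le> \<theta>" and "x > x1"
  shows "mean_return {0} x \<le> ennreal (1 / (1 - \<theta>) / \<gamma> x)"
proof -
  define c where "c = 1 / (1 - \<theta>)"
  have c: "c > 0" "c - c * \<theta> = 1" using assms(2) by (auto simp: c_def field_simps)
  \<comment> \<open>The value \<open>top\<close> makes the drift condition trivial up to
    \<open>x1\<close>. Beyond \<open>x1\<close> it never enters, since the chain killed at 0 only
    moves up.\<close>
  let ?L = "\<lambda>x. if x \<le> x1 then top else ennreal (c / \<gamma> x)"
  have [measurable]: "?L \<in> borel_measurable half_line" by measurable
  have L: "(\<lambda>z. indicator (- {0}) z * ?L z) \<in> borel_measurable half_line" by measurable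
  have "mean_return {0} x \<le> ?L x"
  proof (rule mean_return_le_drift[OF zero_sets])
    fix y assume y: "y \<in> space half_line" "y \<notin> {0}"
    then have "y > 0" by simp
    show "1 + (\<integral>\<^sup>+z. indicator (- {0}) z * ?L z \<partial>jump_kernel \<gamma> \<beta> y) \<le> ?L y"
    proof (cases "y \<le> x1")
      case False
      have \<gamma>: "0 < \<gamma> y" "\<gamma> y < 1" "0 < \<gamma> (y + 1)" using \<gamma>_bounds \<open>y > 0\<close> by auto
      have "1 + (1 - \<gamma> y) * (c / \<gamma> (y + 1)) \<le> c / \<gamma> y"
      proof -
        have "(1 - \<gamma> y) * (c * (1 / \<gamma> (y + 1))) \<le> (1 - \<gamma> y) * (c * (1 / \<gamma> y + \<theta>))"
          using incr[of y] False \<gamma> c by (intro mult_left_mono) auto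
        also have "\<dots> = c / \<gamma> y - (c - c * \<theta>) - c * \<theta> * \<gamma> y"
          using \<gamma> by (simp add: field_simps)
        also have "\<dots> \<le> c / \<gamma> y - 1" using c \<gamma> assms(3) by simp
        finally show ?thesis by simp
      qed
      then have "1 + ennreal (1 - \<gamma> y) * ennreal (c / \<gamma> (y + 1)) \<le> ennreal (c / \<gamma> y)"
        using \<gamma> c by (simp add: ennreal_mult[symmetric] ennreal_plus[symmetric] ennreal_1[symmetric]
            ennreal_leI del: ennreal_plus ennreal_1)
      then show ?thesis
        using nn_integral_jump_kernel_pos[OF \<open>y > 0\<close> L] \<open>y > 0\<close> False assms(1) by simp
    qed simp
  qed (use assms in auto)
  then show ?thesis using assms by (simp add: c_def)
qed

end

locale jump_process = jump_chain \<gamma> \<beta> for \<gamma> \<beta> :: "real \<Rightarrow> real" +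
  fixes PP :: "real \<Rightarrow> 'w measure" and X :: "nat \<Rightarrow> 'w \<Rightarrow> real"
  assumes process: "markov_chain half_line (jump_kernel \<gamma> \<beta>) PP X"
begin

sublocale markov_process half_line "jump_kernel \<gamma> \<beta>" PP X
  by unfold_locales (rule process)

section \<open>Criteria for recurrence, transience and ergodicity\<close>

lemma harris_recurrentI:
  assumes "\<And>x. x > 0 \<Longrightarrow> (\<lambda>n. survive n x) \<longlonglongrightarrow> 0"
  shows "harris_recurrent half_line (jump_kernel \<gamma> \<beta>) PP X"
  unfolding harris_recurrent_def
proof (intro ballI)
  fix x A assume "x \<in> space half_line" and A: "A \<in> positive_sets half_line (jump_kernel \<gamma> \<beta>)"
  then show "\<P>(\<omega> in PP x. (\<Sum>n. indicator A (X (Suc n) \<omega>)) = (\<infinity> :: ennreal)) = 1"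
    using INF_avoid_eq_0[OF assms A] by (intro prob_infinitely_often) (auto simp: positive_sets_iff)
qed

lemma transientI:
  assumes lim: "(\<lambda>n. \<Prod>k=K..n. (INF y\<in>{real k..<real k + 1}. 1 - \<gamma> y)) \<longlonglongrightarrow> L" and L: "L > 0"
  shows "transient half_line (jump_kernel \<gamma> \<beta>)"
proof -
  let ?P = "kernel_pow half_line (jump_kernel \<gamma> \<beta>)"
  \<comment> \<open>Averages the bound of \<open>survive_bounded_below\<close> over the landing
    point of the first step: a lower bound for the probability of never returning to 0.\<close>
  define q where "q = (\<integral>\<^sup>+y\<in>{0<..}. ennreal (\<beta> y) * ennreal (survive K y * L) \<partial>lborel)"
  have "q > 0"
    unfolding q_def using survive_pos L by (intro nn_integral_\<beta>_pos) auto
  have q: "q \<le> avoid {0} k 0" for k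
  proof -
    have "q \<le> avoid {0} (Suc k) 0"
      unfolding avoid_zero_0 q_def
    proof (intro nn_integral_mono)
      fix y
      have "ennreal (survive K y * L) \<le> ennreal (survive k y)" if "y > 0"
        using survive_bounded_below[OF lim, of y k] that by (intro ennreal_leI) simp
      then show "ennreal (\<beta> y) * ennreal (survive K y * L) * indicator {0<..} y
          \<le> ennreal (\<beta> y) * ennreal (survive k y) * indicator {0<..} y"
        by (cases "y > 0") (simp_all add: mult_left_mono)
    qed
    also have "\<dots> \<le> avoid {0} k 0" by (rule avoid_Suc_le) simp
    finally show ?thesis .
  qed
  have "(\<Sum>n. emeasure (?P n 0) {0}) * q \<le> 1"
    using q by (intro green_function_le) auto
  moreover have "\<infinity> * q = \<infinity>" using \<open>q > 0\<close> by (simp add: ennreal_top_mult)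
  ultimately have "(\<Sum>n. emeasure (?P n 0) {0}) \<noteq> \<infinity>"
    by (metis ennreal_one_less_top infinity_ennreal_def leD)
  moreover have "(\<Sum>n. emeasure (?P (Suc n) 0) {0}) \<le> (\<Sum>n. emeasure (?P n 0) {0})"
    by (subst (2) suminf_offset[of _ 1]) (auto simp del: kernel_pow.simps)
  ultimately have "(\<Sum>n. emeasure (?P (Suc n) 0) {0}) \<noteq> \<infinity>"
    by (auto simp: top_unique simp del: kernel_pow.simps)
  then show ?thesis
    unfolding transient_def using zero_positive by (auto simp del: kernel_pow.simps intro!: bexI[of _ "{0}"] bexI[of _ 0])
qed

text \<open>The drift function is the expected time to reach \<open>C\<close> plus a multiple of
  \<open>\<Sum>k<N. avoid {0} k\<close>, which decreases along the chain killed at \<open>0\<close> and does so by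
  at least \<open>\<epsilon>\<close> on \<open>C\<close>.\<close>

lemma ergodic_mean_return_finite:
  assumes "ergodic half_line (jump_kernel \<gamma> \<beta>) PP X"
  shows "mean_return {0} 0 < \<infinity>"
proof -
  obtain C where C: "petite half_line (jump_kernel \<gamma> \<beta>) C" "C \<in> positive_sets half_line (jump_kernel \<gamma> \<beta>)"
    and fin: "(SUP x\<in>C. \<integral>\<^sup>+\<omega>. ennreal_of_enat (return_time X C \<omega>) \<partial>PP x) < \<infinity>"
    using assms by (auto simp: ergodic_def)
  have C_sets [measurable]: "C \<in> sets half_line" using C(1) by (simp add: petite_def)
  have C_sub: "x \<ge> 0" if "x \<in> C" for x using sets.sets_into_space[OF C_sets] that by auto
  have "(SUP x\<in>C. mean_return C x) < \<infinity>"
    using fin C_sub by (simp add: nn_integral_return_time cong: SUP_cong_simp)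
  then obtain M where M: "(SUP x\<in>C. mean_return C x) = ennreal M" "0 \<le> M"
    by (cases "SUP x\<in>C. mean_return C x") auto
  have le_M: "mean_return C x \<le> ennreal M" if "x \<in> C" for x
    unfolding M(1)[symmetric] using that by (rule SUP_upper)
  \<comment> \<open>If 0 is not in \<open>C\<close>, a positive point of \<open>C\<close> jumps to 0
    with positive probability and must then still return to \<open>C\<close>, so its finite mean
    return time controls the one from 0.\<close>
  have fin_0: "mean_return C 0 < \<infinity>"
  proof (cases "0 \<in> C")
    case True
    then show ?thesis using le_M[of 0] by (auto simp: le_less_trans)
  next
    case False
    have "C \<noteq> {}" using C(2) by (auto simp: positive_sets_iff)
    then obtain x where x: "x \<in> C" "x > 0" using C_sub False by (metis all_not_in_conv less_eq_real_def)
    have "ennreal (\<gamma> x) * mean_return C 0 \<le> mean_return C x"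
      using x False
      by (subst (2) mean_return_step) (auto simp: nn_integral_jump_kernel_pos add_increasing add_increasing2)
    also have "\<dots> < \<infinity>" using le_M[OF x(1)] by (auto simp: le_less_trans)
    finally show ?thesis using \<gamma>_pos[of x] x(2) by (auto simp: ennreal_mult_less_top)
  qed
  obtain N \<epsilon> where \<epsilon>: "\<epsilon> > 0" and surv: "\<And>x. x \<in> C \<Longrightarrow> x > 0 \<Longrightarrow> survive N x \<le> 1 - \<epsilon>"
    by (rule petite_survive_le[OF C(1)]) (rule that)
  define U where "U x = (\<Sum>k<N. avoid {0} k x)" for x
  \<comment> \<open>With the weight \<open>M / \<epsilon>\<close>, a decrease of \<open>U\<close> by
    at least \<open>\<epsilon>\<close> on \<open>C\<close> makes up for the bound \<open>M\<close>
    on the mean return time to \<open>C\<close>.\<close>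
  define L where "L x = indicator (- C) x * mean_return C x + ennreal (M / \<epsilon>) * U x" for x
  have [measurable]: "U \<in> borel_measurable half_line"
    unfolding U_def[abs_def] by (intro borel_measurable_sum avoid_measurable zero_sets)
  have U_pos: "U x = ennreal (\<Sum>k<N. survive k x)" if "x > 0" for x
    unfolding U_def using that survive_nonneg[of x] by (simp add: avoid_zero)
  have drift: "1 + (\<integral>\<^sup>+y. indicator (- {0}) y * L y \<partial>jump_kernel \<gamma> \<beta> x) \<le> L x" if x: "x > 0" for x
  proof -
    let ?I = "\<integral>\<^sup>+y. indicator (- C) y * mean_return C y \<partial>jump_kernel \<gamma> \<beta> x"
    let ?T = "\<Sum>k<N. survive (Suc k) x" and ?S = "\<Sum>k<N. survive k x"
    have T: "0 \<le> ?T" "0 \<le> ?S" using survive_nonneg[of x] x by (auto intro!: sum_nonneg)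
    have mult: "ennreal (M / \<epsilon>) * ennreal t = ennreal (M / \<epsilon> * t)" if "0 \<le> t" for t
      using M \<epsilon> that by (intro ennreal_mult[symmetric]) auto
    \<comment> \<open>Telescoping: one step of the chain killed at 0 lowers \<open>U\<close> by
      exactly \<open>1 - survive N x\<close>.\<close>
    have TS: "?T = ?S - (1 - survive N x)"
      using sum_lessThan_telescope[of "\<lambda>k. survive k x" N] by (simp add: sum_subtractf)
    have "(\<integral>\<^sup>+y. indicator (- {0}) y * U y \<partial>jump_kernel \<gamma> \<beta> x) = (\<Sum>k<N. avoid {0} (Suc k) x)"
      unfolding U_def sum_distrib_left using x by (subst nn_integral_sum) auto
    also have "\<dots> = ennreal ?T"
      using x survive_nonneg[of x] by (simp add: avoid_zero del: avoid.simps)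
    finally have U_int: "(\<integral>\<^sup>+y. indicator (- {0}) y * U y \<partial>jump_kernel \<gamma> \<beta> x) = ennreal ?T" .
    have "(\<integral>\<^sup>+y. indicator (- {0}) y * L y \<partial>jump_kernel \<gamma> \<beta> x)
        \<le> (\<integral>\<^sup>+y. indicator (- C) y * mean_return C y + ennreal (M / \<epsilon>) * (indicator (- {0}) y * U y) \<partial>jump_kernel \<gamma> \<beta> x)"
      by (intro nn_integral_mono) (auto simp: L_def split: split_indicator)
    also have "\<dots> = ?I + ennreal (M / \<epsilon>) * ennreal ?T"
      using x by (subst nn_integral_add) (auto simp: nn_integral_cmult U_int)
    finally have "1 + (\<integral>\<^sup>+y. indicator (- {0}) y * L y \<partial>jump_kernel \<gamma> \<beta> x)
        \<le> (1 + ?I) + ennreal (M / \<epsilon>) * ennreal ?T"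
      by (simp add: add.assoc add_left_mono)
    also have "1 + ?I = mean_return C x"
      using x by (subst mean_return_step) auto
    also have "mean_return C x + ennreal (M / \<epsilon>) * ennreal ?T \<le> L x"
    proof (cases "x \<in> C")
      case True
      have "M / \<epsilon> * ?T \<le> M / \<epsilon> * (?S - \<epsilon>)"
        using surv[OF True x] \<epsilon> M unfolding TS by (intro mult_left_mono) auto
      also have "\<dots> = M / \<epsilon> * ?S - M" using \<epsilon> by (simp add: right_diff_distrib)
      finally have *: "M + M / \<epsilon> * ?T \<le> M / \<epsilon> * ?S" by simp
      have "mean_return C x + ennreal (M / \<epsilon>) * ennreal ?T \<le> ennreal M + ennreal (M / \<epsilon>) * ennreal ?T"
        by (intro add_right_mono le_M True)
      also have "\<dots> = ennreal (M + M / \<epsilon> * ?T)"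
        unfolding mult[OF T(1)] using M \<epsilon> T by (intro ennreal_plus[symmetric]) auto
      also have "\<dots> \<le> ennreal (M / \<epsilon> * ?S)" by (intro ennreal_leI *)
      also have "\<dots> = L x" using True mult[OF T(2)] by (simp add: L_def U_pos[OF x])
      finally show ?thesis .
    next
      case False
      have "?T \<le> ?S" using TS survive_le_1[of x N] x by simp
      then show ?thesis
        using False x by (auto simp: L_def U_pos intro!: add_left_mono mult_left_mono ennreal_leI)
    qed
    finally show ?thesis .
  qed
  have le_L: "mean_return {0} y \<le> L y" if "y > 0" for y
    using that by (intro mean_return_le_drift[OF zero_sets] drift) auto
  have U_le: "U y \<le> of_nat N" if "y \<in> space half_line" for y
    using sum_mono[of "{..<N}" "\<lambda>k. avoid {0} k y" "\<lambda>_. 1"] avoid_le_1[OF that] by (simp add: U_def)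
  have "mean_return {0} 0 = 1 + (\<integral>\<^sup>+y. indicator (- {0}) y * mean_return {0} y \<partial>jump_kernel \<gamma> \<beta> 0)"
    by (rule mean_return_step) auto
  also have "\<dots> \<le> 1 + (\<integral>\<^sup>+y. indicator (- C) y * mean_return C y + ennreal (M / \<epsilon>) * of_nat N \<partial>jump_kernel \<gamma> \<beta> 0)"
  proof (intro add_left_mono nn_integral_kernel_mono)
    fix y :: real assume y: "y \<in> space half_line"
    have "L y \<le> indicator (- C) y * mean_return C y + ennreal (M / \<epsilon>) * of_nat N"
      unfolding L_def by (intro add_left_mono mult_left_mono U_le y) simp
    then show "indicator (- {0}) y * mean_return {0} y \<le> indicator (- C) y * mean_return C y + ennreal (M / \<epsilon>) * of_nat N"
      using order_trans[OF le_L[of y]] y by (cases "y = 0") auto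
  qed simp
  also have "\<dots> = mean_return C 0 + ennreal (M / \<epsilon>) * of_nat N"
    using emeasure_kernel_space[of 0]
    by (subst nn_integral_add) (auto simp: mean_return_step[OF C_sets, of 0] add.assoc)
  also have "\<dots> < \<infinity>" using fin_0 by (auto simp: ennreal_mult_less_top of_nat_less_top)
  finally show ?thesis .
qed

text \<open>From \<open>x\<close> on, \<gamma> is at most its supremum there, so the mean return
  time to 0 from \<open>x\<close> is at least the reciprocal. The divergent integral then makes the
  mean return time from 0 infinite.\<close>

lemma not_ergodicI:
  assumes "0 \<le> x1" and inf: "(\<integral>\<^sup>+x\<in>{x1<..}. ennreal (\<beta> x / (SUP y\<in>{x..}. \<gamma> y)) \<partial>lborel) = \<infinity>"
  shows "\<not> ergodic half_line (jump_kernel \<gamma> \<beta>) PP X"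
proof
  assume "ergodic half_line (jump_kernel \<gamma> \<beta>) PP X"
  then have "mean_return {0} 0 < \<infinity>" by (rule ergodic_mean_return_finite)
  moreover have "(\<integral>\<^sup>+x\<in>{x1<..}. ennreal (\<beta> x / (SUP y\<in>{x..}. \<gamma> y)) \<partial>lborel)
      \<le> (\<integral>\<^sup>+x\<in>{0<..}. ennreal (\<beta> x) * mean_return {0} x \<partial>lborel)"
  proof (intro nn_integral_mono)
    fix x
    let ?s = "SUP y\<in>{x..}. \<gamma> y"
    have "ennreal (\<beta> x / ?s) \<le> ennreal (\<beta> x) * mean_return {0} x" if x: "x > 0"
    proof -
      have \<gamma>: "\<gamma> y \<le> ?s" if "y \<ge> x" for y
        using that x \<gamma>_less_1 by (intro cSUP_upper bdd_aboveI[of _ 1]) (auto simp: less_imp_le)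
      have "?s \<le> 1" using x \<gamma>_less_1 by (intro cSUP_least) (auto simp: less_imp_le)
      moreover have "?s > 0" using \<gamma>[of x] \<gamma>_pos[of x] x by simp
      ultimately have "ennreal (1 / ?s) \<le> mean_return {0} x"
        using x \<gamma> by (intro mean_return_zero_ge) auto
      then have "ennreal (\<beta> x) * ennreal (1 / ?s) \<le> ennreal (\<beta> x) * mean_return {0} x"
        by (rule mult_left_mono) simp
      then show ?thesis using \<beta>_nonneg[of x] \<open>?s > 0\<close> by (simp add: ennreal_mult[symmetric])
    qed
    then show "ennreal (\<beta> x / ?s) * indicator {x1<..} x \<le> ennreal (\<beta> x) * mean_return {0} x * indicator {0<..} x"
      using assms(1) by (auto split: split_indicator)
  qed
  ultimately show False using inf by (simp add: mean_return_zero_0 top_unique)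
qed

lemma ergodicI:
  assumes x1: "x1 > 0" and incr: "(SUP x\<in>{x1<..}. ereal (1 / \<gamma> (x + 1) - 1 / \<gamma> x)) < 1"
    and int: "(\<integral>\<^sup>+y\<in>{x1<..}. ennreal (\<beta> y / \<gamma> y) \<partial>lborel) < \<infinity>"
  shows "ergodic half_line (jump_kernel \<gamma> \<beta>) PP X"
proof -
  obtain t where t: "(SUP x\<in>{x1<..}. ereal (1 / \<gamma> (x + 1) - 1 / \<gamma> x)) < ereal t" "ereal t < 1"
    using ereal_dense2[OF incr] by blast
  \<comment> \<open>The strict inequality leaves room for a real bound \<open>t\<close> below 1; the
    Lyapunov bound asks for a nonnegative one.\<close>
  define \<theta> where "\<theta> = max t 0"
  have \<theta>: "\<theta> < 1" "0 \<le> \<theta>" using t by (auto simp: \<theta>_def one_ereal_def)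
  have \<theta>_incr: "1 / \<gamma> (x + 1) - 1 / \<gamma> x \<le> \<theta>" if "x > x1" for x
  proof -
    have "ereal (1 / \<gamma> (x + 1) - 1 / \<gamma> x) \<le> (SUP x\<in>{x1<..}. ereal (1 / \<gamma> (x + 1) - 1 / \<gamma> x))"
      using that by (intro SUP_upper) auto
    then have "ereal (1 / \<gamma> (x + 1) - 1 / \<gamma> x) < ereal t" using t(1) by (rule le_less_trans)
    then show ?thesis by (simp add: \<theta>_def)
  qed
  define c where "c = 1 / (1 - \<theta>)"
  have "c > 0" using \<theta> by (simp add: c_def)
  have far: "mean_return {0} x \<le> ennreal (c / \<gamma> x)" if "x > x1" for x
    unfolding c_def using x1 that by (intro mean_return_zero_le_inverse \<theta> \<theta>_incr) auto
  \<comment> \<open>Enough steps for a climb from any point of the interval from 0 to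
    \<open>x1\<close> to pass \<open>x1\<close>, where the bound \<open>far\<close> applies.\<close>
  define K where "K = nat \<lceil>x1\<rceil>"
  obtain d where d: "d > 0" "\<And>y. 0 \<le> y \<Longrightarrow> y \<le> x1 + real K \<Longrightarrow> d \<le> \<gamma> y"
    using \<gamma>_bounded_below_compact by blast
  have near: "mean_return {0} x \<le> ennreal (real K + c / d)" if "0 < x" "x \<le> x1" for x
  proof -
    have "x + real K > x1" using that unfolding K_def by linarith
    then have "mean_return {0} (x + real K) \<le> ennreal (c / \<gamma> (x + real K))" by (rule far)
    also have "\<dots> \<le> ennreal (c / d)"
      using d(1) d(2)[of "x + real K"] that \<open>c > 0\<close> by (intro ennreal_leI divide_left_mono) auto
    finally have "of_nat K + mean_return {0} (x + real K) \<le> of_nat K + ennreal (c / d)"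
      by (rule add_left_mono)
    with mean_return_zero_shift_le[OF that(1), of K] have "mean_return {0} x \<le> of_nat K + ennreal (c / d)"
      by (rule order_trans)
    then show ?thesis using \<open>c > 0\<close> d(1) by (simp add: ennreal_of_nat_eq_real_of_nat)
  qed
  define D where "D = real K + c / d"
  have "mean_return {0} x < \<infinity>" if "x > 0" for x
  proof (cases "x > x1")
    case True
    then show ?thesis using far[of x] by (auto simp: le_less_trans)
  next
    case False
    then show ?thesis using near[of x] that by (auto simp: le_less_trans)
  qed
  then have harris: "harris_recurrent half_line (jump_kernel \<gamma> \<beta>) PP X"
    by (intro harris_recurrentI survive_tendsto_0_if_mean_return)
  \<comment> \<open>Extension of \<gamma> by 0 to a Borel function on the line; it agrees with
    \<gamma> beyond \<open>x1\<close>.\<close>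
  define g where "g y = indicator {0..} y * \<gamma> y" for y
  have "g \<in> borel_measurable borel"
    using \<gamma>_measurable unfolding half_line_def g_def
    by (subst (asm) borel_measurable_restrict_space_iff) auto
  then have "(\<lambda>y. ennreal (\<beta> y / g y) * indicator {x1<..} y) \<in> borel_measurable lborel"
    using \<beta>_meas
    by (intro borel_measurable_times_ennreal measurable_compose[OF borel_measurable_divide measurable_ennreal])
      simp_all
  also have "(\<lambda>y. ennreal (\<beta> y / g y) * indicator {x1<..} y) = (\<lambda>y. ennreal (\<beta> y / \<gamma> y) * indicator {x1<..} y)"
    using x1 by (auto simp: g_def fun_eq_iff split: split_indicator)
  finally have far_meas: "(\<lambda>y. ennreal (\<beta> y / \<gamma> y) * indicator {x1<..} y) \<in> borel_measurable lborel" .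
  have "(\<integral>\<^sup>+y\<in>{0<..}. ennreal (\<beta> y) * mean_return {0} y \<partial>lborel)
      \<le> (\<integral>\<^sup>+y. ennreal D * ennreal (\<beta> y) + ennreal c * (ennreal (\<beta> y / \<gamma> y) * indicator {x1<..} y) \<partial>lborel)"
  proof (intro nn_integral_mono)
    fix y
    show "ennreal (\<beta> y) * mean_return {0} y * indicator {0<..} y
        \<le> ennreal D * ennreal (\<beta> y) + ennreal c * (ennreal (\<beta> y / \<gamma> y) * indicator {x1<..} y)"
    proof (cases "y > x1")
      case True
      have "ennreal (\<beta> y) * mean_return {0} y \<le> ennreal (\<beta> y) * ennreal (c / \<gamma> y)"
        by (intro mult_left_mono far True) simp
      also have "\<dots> = ennreal c * ennreal (\<beta> y / \<gamma> y)"
        using \<gamma>_pos[of y] True x1 \<open>c > 0\<close> \<beta>_nonneg[of y] by (simp add: ennreal_mult[symmetric] mult.commute)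
      finally show ?thesis using True x1 by (simp add: add_increasing)
    next
      case False
      have "ennreal (\<beta> y) * mean_return {0} y \<le> ennreal (\<beta> y) * ennreal D" if "y > 0"
        unfolding D_def using False that by (intro mult_left_mono near) auto
      then show ?thesis using False by (auto simp: mult.commute split: split_indicator)
    qed
  qed
  also have "\<dots> = ennreal D + ennreal c * (\<integral>\<^sup>+y\<in>{x1<..}. ennreal (\<beta> y / \<gamma> y) \<partial>lborel)"
    using far_meas by (subst nn_integral_add) (auto simp: nn_integral_cmult \<beta>_density)
  also have "\<dots> < \<infinity>" using int by (auto simp: ennreal_mult_less_top)
  finally have "mean_return {0} 0 < \<infinity>" by (simp add: mean_return_zero_0)
  then show ?thesis
    unfolding ergodic_def using harris petite_zero zero_positive
    by (intro conjI exI[of _ "{0}"]) (auto simp: nn_integral_return_time)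
qed

section \<open>Consequences of \<gamma> vanishing at infinity\<close>

lemma petite_bounded:
  assumes vanish: "\<And>\<eta>. \<eta> > 0 \<Longrightarrow> \<exists>R>0. \<forall>y\<ge>R. \<gamma> y \<le> \<eta>"
    and C: "petite half_line (jump_kernel \<gamma> \<beta>) C"
  obtains R where "R > 0" "\<And>x. x \<in> C \<Longrightarrow> x < R"
proof -
  obtain N \<epsilon> where \<epsilon>: "\<epsilon> > 0" and surv: "\<And>x. x \<in> C \<Longrightarrow> x > 0 \<Longrightarrow> survive N x \<le> 1 - \<epsilon>"
    by (rule petite_survive_le[OF C]) (rule that)
  \<comment> \<open>By Bernoulli's inequality, \<open>N\<close> climbs in a row then succeed with
    probability at least \<open>1 - N * \<eta>\<close>, more than \<open>1 - \<epsilon>\<close>,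
    wherever \<gamma> stays below \<eta>; so \<open>C\<close> has no point there.\<close>
  define \<eta> where "\<eta> = min 1 (\<epsilon> / (real N + 1))"
  have \<eta>: "0 < \<eta>" "\<eta> \<le> 1" using \<epsilon> by (auto simp: \<eta>_def)
  have "\<eta> * (real N + 1) \<le> \<epsilon>"
    unfolding \<eta>_def by (simp add: min_def pos_le_divide_eq)
  then have N\<eta>: "real N * \<eta> < \<epsilon>" using \<eta> by (simp add: algebra_simps)
  obtain R where R: "R > 0" "\<forall>y\<ge>R. \<gamma> y \<le> \<eta>" using vanish[OF \<eta>(1)] by blast
  have "x < R" if "x \<in> C" for x
  proof (rule ccontr)
    assume "\<not> x < R"
    then have x: "x \<ge> R" by simp
    have "1 - real N * \<eta> \<le> (1 - \<eta>) ^ N"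
      using Bernoulli_inequality[of "- \<eta>" N] \<eta> by simp
    also have "\<dots> \<le> survive N x" using x R \<eta> by (intro survive_ge_power) auto
    also have "\<dots> \<le> 1 - \<epsilon>" using surv[OF that] x R by simp
    finally show False using N\<eta> by simp
  qed
  then show ?thesis using R that by blast
qed

lemma not_strongly_ergodicI:
  assumes vanish: "\<And>\<eta>. \<eta> > 0 \<Longrightarrow> \<exists>R>0. \<forall>y\<ge>R. \<gamma> y \<le> \<eta>"
  shows "\<not> strongly_ergodic half_line (jump_kernel \<gamma> \<beta>) PP X"
proof
  assume "strongly_ergodic half_line (jump_kernel \<gamma> \<beta>) PP X"
  then obtain C where C: "petite half_line (jump_kernel \<gamma> \<beta>) C"
    and fin: "(SUP x\<in>space half_line. \<integral>\<^sup>+\<omega>. ennreal_of_enat (return_time X C \<omega>) \<partial>PP x) < \<infinity>"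
    by (auto simp: strongly_ergodic_def)
  have C_sets [measurable]: "C \<in> sets half_line" using C by (simp add: petite_def)
  define s where "s = (SUP x\<in>space half_line. mean_return C x)"
  have "s < \<infinity>"
    using fin by (simp add: s_def nn_integral_return_time del: space_half_line cong: SUP_cong_simp)
  then obtain M where M: "s = ennreal M" "0 \<le> M"
    by (cases s) auto
  obtain R where R: "R > 0" "\<And>x. x \<in> C \<Longrightarrow> x < R"
    using petite_bounded[OF vanish C] by blast
  define \<eta> where "\<eta> = 1 / (M + 1)"
  have \<eta>: "0 < \<eta>" "\<eta> \<le> 1" using M by (auto simp: \<eta>_def)
  obtain R' where R': "R' > 0" "\<forall>y\<ge>R'. \<gamma> y \<le> \<eta>" using vanish[OF \<eta>(1)] by blast
  \<comment> \<open>This start lies above all of \<open>C\<close>, so the climb misses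
    \<open>C\<close>, and \<gamma> is at most \<open>1 / (M + 1)\<close> from there on, so the mean
    time to 0 is at least \<open>M + 1\<close>.\<close>
  define x where "x = max R R'"
  have x: "x > 0" "x \<ge> R" "x \<ge> R'" using R by (auto simp: x_def)
  have "ennreal (M + 1) = ennreal (1 / \<eta>)" using M by (simp add: \<eta>_def)
  also have "\<dots> \<le> mean_return {0} x" using x R' \<eta> by (intro mean_return_zero_ge) auto
  also have "\<dots> \<le> mean_return C x"
    unfolding mean_return_zero[OF x(1)] mean_return_def[of C]
  proof (intro suminf_le survive_le_avoid)
    show "x + real j \<notin> C" for j using R(2)[of "x + real j"] x by auto
  qed (use x in auto)
  also have "\<dots> \<le> ennreal M" unfolding M(1)[symmetric] s_def using x by (intro SUP_upper) auto
  finally show False using M(2) by (simp add: ennreal_le_iff)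
qed

text \<open>Eventually \<open>\<gamma> \<le> 1 - 1 / r\<close>, so each further survival factor is
  at least \<open>1 / r\<close>. The terms then stay above the positive constant
  \<open>survive K y\<close> and are not summable.\<close>

lemma suminf_power_survive:
  assumes vanish: "\<And>\<eta>. \<eta> > 0 \<Longrightarrow> \<exists>R>0. \<forall>y\<ge>R. \<gamma> y \<le> \<eta>" and r: "r > 1" and y: "y > 0"
  shows "(\<Sum>n. ennreal (r ^ n) * ennreal (survive n y)) = \<infinity>"
proof (rule ccontr)
  assume "\<not> ?thesis"
  then have "(\<Sum>n. ennreal (r ^ n * survive n y)) \<noteq> top"
    using r survive_nonneg[of y] y by (simp add: ennreal_mult)
  then have "summable (\<lambda>n. r ^ n * survive n y)"
    using r survive_nonneg[of y] y by (intro summable_suminf_not_top) auto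
  then have lim: "(\<lambda>n. r ^ n * survive n y) \<longlonglongrightarrow> 0" by (rule summable_LIMSEQ_zero)
  obtain R where R: "R > 0" "\<forall>z\<ge>R. \<gamma> z \<le> 1 - 1 / r" using vanish[of "1 - 1 / r"] r by auto
  define K where "K = nat \<lceil>R\<rceil>"
  have K: "y + real K \<ge> R" using y unfolding K_def by linarith
  have "survive K y \<le> r ^ (K + n) * survive (K + n) y" for n
  proof -
    have "1 = r ^ n * (1 - (1 - 1 / r)) ^ n" using r by (simp add: power_mult_distrib[symmetric])
    also have "\<dots> \<le> r ^ n * survive n (y + real K)"
      using r K R y by (intro mult_left_mono survive_ge_power) auto
    also have "\<dots> \<le> r ^ (K + n) * survive n (y + real K)"
      using r survive_nonneg[of "y + real K" n] y by (intro mult_right_mono power_increasing) auto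
    finally have "survive K y * 1 \<le> survive K y * (r ^ (K + n) * survive n (y + real K))"
      using survive_nonneg[of y K] y by (intro mult_left_mono) auto
    then show ?thesis by (simp add: survive_add mult_ac)
  qed
  then have "survive K y \<le> 0"
    by (intro LIMSEQ_le_const[OF LIMSEQ_ignore_initial_segment[OF lim, of K]] exI[of _ 0] allI impI)
      (simp only: add.commute[of _ K])
  then show False using survive_pos[of y K] y by simp
qed

text \<open>Some point of \<open>C\<close> has an infinite exponential moment: the last point of
  \<open>C\<close> on an orbit, from which the climb never meets \<open>C\<close> again, or 0 itself
  when \<open>C = {0}\<close>.\<close>

lemma not_geometrically_ergodicI:
  assumes vanish: "\<And>\<eta>. \<eta> > 0 \<Longrightarrow> \<exists>R>0. \<forall>y\<ge>R. \<gamma> y \<le> \<eta>"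
  shows "\<not> geometrically_ergodic half_line (jump_kernel \<gamma> \<beta>) PP X"
proof
  assume "geometrically_ergodic half_line (jump_kernel \<gamma> \<beta>) PP X"
  then obtain C r where C: "petite half_line (jump_kernel \<gamma> \<beta>) C" "C \<noteq> {}" and r: "r > 1"
    and fin: "(SUP x\<in>C. \<integral>\<^sup>+\<omega>. power_enat r (return_time X C \<omega>) \<partial>PP x) < \<infinity>"
    by (auto simp: geometrically_ergodic_def)
  have C_sets [measurable]: "C \<in> sets half_line" using C by (simp add: petite_def)
  have C_sub: "x \<ge> 0" if "x \<in> C" for x using sets.sets_into_space[OF C_sets] that by auto
  have not_inf: "(\<Sum>n. ennreal (r ^ n) * avoid C n x) \<noteq> \<infinity>" if "x \<in> C" for x
  proof
    assume inf: "(\<Sum>n. ennreal (r ^ n) * avoid C n x) = \<infinity>"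
    have "ennreal (r - 1) * (\<Sum>n. ennreal (r ^ n) * avoid C n x)
        \<le> (\<integral>\<^sup>+\<omega>. power_enat r (return_time X C \<omega>) \<partial>PP x)"
      using C_sub[OF that] r by (intro power_return_time_ge) auto
    also have "\<dots> \<le> (SUP x\<in>C. \<integral>\<^sup>+\<omega>. power_enat r (return_time X C \<omega>) \<partial>PP x)"
      using that by (rule SUP_upper)
    finally have "ennreal (r - 1) * \<infinity> \<le> (SUP x\<in>C. \<integral>\<^sup>+\<omega>. power_enat r (return_time X C \<omega>) \<partial>PP x)"
      unfolding inf .
    moreover have "ennreal (r - 1) * \<infinity> = \<infinity>" using r by (simp add: ennreal_mult_top)
    ultimately show False using fin by (metis leD)
  qed
  show False
  proof (cases "\<exists>x\<in>C. x > 0")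
    case True
    then obtain x where x: "x \<in> C" "x > 0" by blast
    obtain R where R: "\<And>x. x \<in> C \<Longrightarrow> x < R"
      using petite_bounded[OF vanish C(1)] by blast
    \<comment> \<open>Finite because \<open>C\<close> is bounded, so the orbit of \<open>x\<close>
      has a last point in \<open>C\<close>.\<close>
    define J where "J = {j::nat. x + real j \<in> C}"
    have "J \<subseteq> {..nat \<lceil>R\<rceil>}"
    proof
      fix j assume "j \<in> J"
      then have "x + real j < R" using R by (simp add: J_def)
      then show "j \<in> {..nat \<lceil>R\<rceil>}" using x(2) by simp linarith
    qed
    then have J: "finite J" by (rule finite_subset) simp
    moreover have "0 \<in> J" using x by (simp add: J_def)
    ultimately have "Max J \<in> J" by (intro Max_in) auto
    define z where "z = x + real (Max J)"
    have z: "z \<in> C" "z > 0" using \<open>Max J \<in> J\<close> x by (auto simp: z_def J_def)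
    have beyond: "z + real j \<notin> C" if "j \<ge> 1" for j
    proof
      assume "z + real j \<in> C"
      then have "Max J + j \<in> J" by (simp add: z_def J_def algebra_simps)
      then have "Max J + j \<le> Max J" using J by (intro Max_ge)
      then show False using that by simp
    qed
    have "\<infinity> = (\<Sum>n. ennreal (r ^ n) * ennreal (survive n z))"
      using suminf_power_survive[OF vanish r z(2)] by simp
    also have "\<dots> \<le> (\<Sum>n. ennreal (r ^ n) * avoid C n z)"
      using z beyond by (intro suminf_le mult_left_mono survive_le_avoid) auto
    finally show False using not_inf[OF z(1)] by (simp add: top_unique)
  next
    case False
    then have C0: "C = {0}" using C(2) C_sub by (auto simp: less_le)
    have "(\<Sum>n. ennreal (r ^ n) * avoid {0} (Suc n) 0)
        = (\<integral>\<^sup>+y. (\<Sum>n. ennreal (r ^ n) * (indicator (- {0}) y * avoid {0} n y)) \<partial>jump_kernel \<gamma> \<beta> 0)"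
      by (subst nn_integral_suminf) (auto simp: nn_integral_cmult)
    \<comment> \<open>Every landing point \<open>y > 0\<close> already gives an infinite
      sum.\<close>
    also have "\<dots> = (\<integral>\<^sup>+y. \<infinity> * (indicator (- {0}) y * avoid {0} 0 y) \<partial>jump_kernel \<gamma> \<beta> 0)"
    proof (intro nn_integral_cong)
      fix y assume "y \<in> space (jump_kernel \<gamma> \<beta> 0)"
      then have "y \<ge> 0" by simp
      then show "(\<Sum>n. ennreal (r ^ n) * (indicator (- {0}) y * avoid {0} n y)) = \<infinity> * (indicator (- {0}) y * avoid {0} 0 y)"
        using suminf_power_survive[OF vanish r, of y] by (cases "y = 0") (auto simp: avoid_zero)
    qed
    also have "\<dots> = \<infinity> * avoid {0} (Suc 0) 0"
      unfolding avoid.simps(2) by (rule nn_integral_cmult) simp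
    also have "avoid {0} (Suc 0) 0 = 1"
      unfolding avoid_zero_0 using nn_integral_\<beta> by simp
    finally have "\<infinity> = (\<Sum>n. ennreal (r ^ n) * avoid {0} (Suc n) 0)" by simp
    \<comment> \<open>Raising the exponent by one aligns it with the index of
      \<open>avoid\<close>.\<close>
    also have "\<dots> \<le> (\<Sum>n. ennreal (r ^ Suc n) * avoid {0} (Suc n) 0)"
      using r by (intro suminf_le mult_right_mono ennreal_leI power_increasing) auto
    also have "\<dots> \<le> (\<Sum>n. ennreal (r ^ n) * avoid {0} n 0)"
      by (subst (2) suminf_offset[of _ 1]) (auto simp del: avoid.simps power_Suc)
    finally show False using not_inf[of 0] by (simp add: C0 top_unique)
  qed
qed

text \<open>A uniform lower bound on \<gamma> dominates the time to 0 from every positive state by a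
  geometric one; a start at 0 adds a single step.\<close>

lemma strongly_ergodicI:
  assumes \<eta>: "\<eta> > 0" "\<And>y. y \<ge> 0 \<Longrightarrow> \<eta> \<le> \<gamma> y"
  shows "strongly_ergodic half_line (jump_kernel \<gamma> \<beta>) PP X"
proof -
  have pos: "mean_return {0} x \<le> ennreal (1 / \<eta>)" if "x > 0" for x
    using that \<eta> by (intro mean_return_zero_le) auto
  have "mean_return {0} 0 \<le> 1 + (\<integral>\<^sup>+y\<in>{0<..}. ennreal (\<beta> y) * ennreal (1 / \<eta>) \<partial>lborel)"
    unfolding mean_return_zero_0 using pos
    by (intro add_left_mono nn_integral_mono) (auto intro!: mult_left_mono split: split_indicator)
  also have "(\<integral>\<^sup>+y\<in>{0<..}. ennreal (\<beta> y) * ennreal (1 / \<eta>) \<partial>lborel)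
      = (\<integral>\<^sup>+y. ennreal (1 / \<eta>) * (ennreal (\<beta> y) * indicator {0<..} y) \<partial>lborel)"
    by (simp add: mult_ac)
  also have "\<dots> = ennreal (1 / \<eta>)"
    by (subst nn_integral_cmult) (auto simp: nn_integral_\<beta>)
  finally have zero: "mean_return {0} 0 \<le> 1 + ennreal (1 / \<eta>)" .
  have "(SUP x\<in>space half_line. \<integral>\<^sup>+\<omega>. ennreal_of_enat (return_time X {0} \<omega>) \<partial>PP x) \<le> 1 + ennreal (1 / \<eta>)"
  proof (rule SUP_least)
    fix x assume x: "x \<in> space half_line"
    show "(\<integral>\<^sup>+\<omega>. ennreal_of_enat (return_time X {0} \<omega>) \<partial>PP x) \<le> 1 + ennreal (1 / \<eta>)"
    proof (cases "x = 0")
      case True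
      then show ?thesis using nn_integral_return_time[OF x zero_sets] zero by simp
    next
      case False
      then have "mean_return {0} x \<le> ennreal (1 / \<eta>)" using x by (intro pos) simp
      also have "\<dots> \<le> 1 + ennreal (1 / \<eta>)" by (rule add_increasing) simp_all
      finally show ?thesis using nn_integral_return_time[OF x zero_sets] by simp
    qed
  qed
  also have "\<dots> < \<infinity>" by simp
  finally show ?thesis unfolding strongly_ergodic_def using petite_zero by blast
qed

end

theorem proposition1p8:
  fixes \<gamma> \<beta> :: "real \<Rightarrow> real" and a :: ereal
    and PP :: "real \<Rightarrow> 'w measure" and X :: "nat \<Rightarrow> 'w \<Rightarrow> real"
  assumes \<gamma>_cont: "continuous_on {0..} \<gamma>"
    and \<gamma>_bounds: "\<And>x. x \<ge> 0 \<Longrightarrow> 0 < \<gamma> x \<and> \<gamma> x < 1"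
    and a_pos: "0 < a"
    and \<beta>_meas: "\<beta> \<in> borel_measurable borel"
    and \<beta>_nonneg: "\<And>x. 0 \<le> \<beta> x"
    and \<beta>_density: "(\<integral>\<^sup>+x. ennreal (\<beta> x) \<partial>lborel) = 1"
    and \<beta>_support: "{x. \<beta> x \<noteq> 0} = {x. 0 < x \<and> ereal x < a}"
    and chain: "markov_chain half_line (jump_kernel \<gamma> \<beta>) PP X"
  shows
    "((\<exists>x1>0. (\<lambda>n. \<Prod>k=nat \<lfloor>x1::real\<rfloor>..n. (SUP x\<in>{real k..<real k + 1}. 1 - \<gamma> x)) \<longlonglongrightarrow> 0)
        \<longrightarrow> harris_recurrent half_line (jump_kernel \<gamma> \<beta>) PP X)
     \<and>
     ((\<exists>x1>0. \<exists>L>0. (\<lambda>n. \<Prod>k=nat \<lfloor>x1::real\<rfloor>..n. (INF x\<in>{real k..<real k + 1}. 1 - \<gamma> x)) \<longlonglongrightarrow> L)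
        \<longrightarrow> transient half_line (jump_kernel \<gamma> \<beta>))
     \<and>
     ((\<exists>x1>0. (\<integral>\<^sup>+x\<in>{x1<..}. ennreal (\<beta> x / (SUP y\<in>{x..}. \<gamma> y)) \<partial>lborel) = \<infinity>)
        \<longrightarrow> \<not> ergodic half_line (jump_kernel \<gamma> \<beta>) PP X)
     \<and>
     ((\<exists>x1>0. (SUP x\<in>{x1<..}. ereal (1 / \<gamma> (x + 1) - 1 / \<gamma> x)) < 1 \<and>
              (\<integral>\<^sup>+y\<in>{x1<..}. ennreal (\<beta> y / \<gamma> y) \<partial>lborel) < \<infinity>)
        \<longrightarrow> ergodic half_line (jump_kernel \<gamma> \<beta>) PP X)
     \<and>
     (Limsup at_top (\<lambda>x. ereal (\<gamma> x)) = 0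
        \<longrightarrow> \<not> geometrically_ergodic half_line (jump_kernel \<gamma> \<beta>) PP X \<and>
            \<not> strongly_ergodic half_line (jump_kernel \<gamma> \<beta>) PP X)
     \<and>
     (Liminf at_top (\<lambda>x. ereal (\<gamma> x)) > 0
        \<longrightarrow> strongly_ergodic half_line (jump_kernel \<gamma> \<beta>) PP X)"
proof -
  have \<beta>_zero: "\<beta> x = 0" if "x \<le> 0" for x
  proof -
    have "x \<notin> {x. 0 < x \<and> ereal x < a}" using that by simp
    then show ?thesis unfolding \<beta>_support[symmetric] by simp
  qed
  interpret jump_process \<gamma> \<beta> PP X
    by unfold_locales (fact \<gamma>_cont \<gamma>_bounds \<beta>_meas \<beta>_nonneg \<beta>_density \<beta>_zero chain)+
  have vanish: "\<exists>R>0. \<forall>y\<ge>R. \<gamma> y \<le> \<eta>"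
    if "Limsup at_top (\<lambda>x. ereal (\<gamma> x)) = 0" "\<eta> > 0" for \<eta>
  proof -
    have "\<forall>\<^sub>F x in at_top. ereal (\<gamma> x) < ereal \<eta>"
      using that by (intro Limsup_lessD) auto
    then obtain R where "\<forall>x\<ge>R. \<gamma> x < \<eta>" by (auto simp: eventually_at_top_linorder)
    then show ?thesis by (intro exI[of _ "max R 1"]) (auto simp: less_imp_le)
  qed
  \<comment> \<open>The lower limit controls \<gamma> only near infinity; on the remaining compact
    interval continuity and positivity give a bound.\<close>
  have bounded: "\<exists>\<eta>>0. \<forall>y\<ge>0. \<eta> \<le> \<gamma> y" if liminf: "Liminf at_top (\<lambda>x. ereal (\<gamma> x)) > 0"
  proof -
    obtain c where c: "0 < ereal c" "ereal c < Liminf at_top (\<lambda>x. ereal (\<gamma> x))"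
      using ereal_dense2[OF liminf] by blast
    have "\<forall>\<^sub>F x in at_top. ereal c < ereal (\<gamma> x)" using c(2) by (rule less_LiminfD)
    then obtain R where R: "\<forall>x\<ge>R. c < \<gamma> x" by (auto simp: eventually_at_top_linorder)
    obtain d where d: "d > 0" "\<And>y. 0 \<le> y \<Longrightarrow> y \<le> R \<Longrightarrow> d \<le> \<gamma> y"
      using \<gamma>_bounded_below_compact by blast
    have "min c d \<le> \<gamma> y" if "y \<ge> 0" for y
      using R[rule_format, of y] d(2)[OF that] by (cases "y \<ge> R") auto
    then show ?thesis using c(1) d(1) by (intro exI[of _ "min c d"]) auto
  qed
  show ?thesis
  proof (intro conjI impI)
    assume "\<exists>x1>0. (\<lambda>n. \<Prod>k=nat \<lfloor>x1::real\<rfloor>..n. (SUP x\<in>{real k..<real k + 1}. 1 - \<gamma> x)) \<longlonglongrightarrow> 0"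
    then show "harris_recurrent half_line (jump_kernel \<gamma> \<beta>) PP X"
      using survive_tendsto_0 harris_recurrentI by blast
  next
    assume "\<exists>x1>0. \<exists>L>0. (\<lambda>n. \<Prod>k=nat \<lfloor>x1::real\<rfloor>..n. (INF x\<in>{real k..<real k + 1}. 1 - \<gamma> x)) \<longlonglongrightarrow> L"
    then show "transient half_line (jump_kernel \<gamma> \<beta>)"
      using transientI by blast
  next
    assume "\<exists>x1>0. (\<integral>\<^sup>+x\<in>{x1<..}. ennreal (\<beta> x / (SUP y\<in>{x..}. \<gamma> y)) \<partial>lborel) = \<infinity>"
    then show "\<not> ergodic half_line (jump_kernel \<gamma> \<beta>) PP X"
      using not_ergodicI by (metis less_imp_le)
  next
    assume "\<exists>x1>0. (SUP x\<in>{x1<..}. ereal (1 / \<gamma> (x + 1) - 1 / \<gamma> x)) < 1 \<and>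
              (\<integral>\<^sup>+y\<in>{x1<..}. ennreal (\<beta> y / \<gamma> y) \<partial>lborel) < \<infinity>"
    then show "ergodic half_line (jump_kernel \<gamma> \<beta>) PP X"
      using ergodicI by blast
  next
    assume "Limsup at_top (\<lambda>x. ereal (\<gamma> x)) = 0"
    then show "\<not> geometrically_ergodic half_line (jump_kernel \<gamma> \<beta>) PP X"
      and "\<not> strongly_ergodic half_line (jump_kernel \<gamma> \<beta>) PP X"
      using not_geometrically_ergodicI not_strongly_ergodicI vanish by blast+
  next
    assume "Liminf at_top (\<lambda>x. ereal (\<gamma> x)) > 0"
    then show "strongly_ergodic half_line (jump_kernel \<gamma> \<beta>) PP X"
      using bounded strongly_ergodicI by blast
  qed
qed

end
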